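(* Let $n\ge1$, $\kappa\ge1$. Suppose that, after performing a finite number of loops of the algorithm generating invariants (described in the context), one has obtained a finite list of $1+M$ mutually independent invariants $f_1',\Lambda^{l_1},\dots,\Lambda^{l_M}\in E_\kappa^n$, of weights $1,l_1,\dots,l_M$, such that the ideal of relations $$\{S\in\mathbb{C}[A_1,\dots,A_M]:\ S(\Lambda^{l_1}|_0,\dots,\Lambda^{l_M}|_0)\equiv0\}$$ between their restrictions to $\{f_1'=0\}$ has, for a certain monomial order, a reduced Gröbner basis $\langle{\sf S}_i\rangle_{1\le i\le N}$ consisting of weighted homogeneous polynomials, with the property that there are polynomials ${\sf R}_i$ with, without setting $f_1'=0$, $$0\equiv{\sf S}_i(\Lambda^{l_1},\dots,\Lambda^{l_M})-f_1'\,{\sf R}_i(f_1',\Lambda^{l_1},\dots,\Lambda^{l_M})\qquad(i=1,\dots,N)$$ (so that no new invariant appears). Then the algorithm terminates, and the algebra of invariants is generated by this list: $$E_\kappa^n=\mathbb{C}\big[f_1',\Lambda^{l_1},\dots,\Lambda^{l_M}\big]\ \ \text{modulo syzygies}.$$ Moreover, if $(\Lambda^{l_1})^{\alpha_1^i}\cdots(\Lambda^{l_M})^{\alpha_M^i}$ is the leading monomial of ${\sf S}_i$ and $\square_i=\alpha^i+\mathbb{N}^M$, then every invariant in $E_{\kappa,m}^n$ of weight $m$ can be written uniquely as $$\sum_{0\le a\le m}(f_1')^a\,\widetilde{\sf P}_a\big(\Lambda^{l_1},\dots,\Lambda^{l_M}\big),\qquad \widetilde{\sf P}_a=\sum_{\substack{(b_1,\dots,b_M)\in\mathbb{N}^M\setminus(\square_1\cup\dots\cup\square_N)\\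 l_1b_1+\dots+l_Mb_M=m-a}}{\sf coeff}_{a;b_1,\dots,b_M}\,(\Lambda^{l_1})^{b_1}\cdots(\Lambda^{l_M})^{b_M},$$ with complex coefficients ${\sf coeff}_{a;b_1,\dots,b_M}$ subject to no restriction.
   Context: $\mathbb{C}[j^\kappa f]$ is the polynomial ring in the variables $f_i^{(\lambda)}$, $1\le i\le n$, $1\le\lambda\le\kappa$ (jet coordinates of germs $f:(\mathbb{C},0)\to\mathbb{C}^n$). ${\sf P}\in\mathbb{C}[j^\kappa f]$ is an invariant (by reparametrization) of weight $m$ if ${\sf P}(j^\kappa(f\circ\phi))=(\phi')^m{\sf P}((j^\kappa f)\circ\phi)$ for all local biholomorphisms $\phi$ of $(\mathbb{C},0)$; $E_{\kappa,m}^n$ is the space of these and $E_\kappa^n=\oplus_mE_{\kappa,m}^n$ the graded algebra. ${\sf P}|_0$ denotes ${\sf P}$ with the single variable $f_1'$ set equal to $0$. A list of invariants is mutually independent if no member is a polynomial in the others. In $\mathbb{C}[A_1,\dots,A_M]$, weighted homogeneity is with respect to giving $A_j$ the weight $l_j$ of the corresponding invariant. Bracket: $[{\sf P},{\sf Q}]=q\,{\sf D}{\sf P}\cdot{\sf Q}-p\,{\sf P}\cdot{\sf D}{\sf Q}$ for invariants of weights $p,q$, with ${\sf D}=\sum_{k,\lambda}f_k^{(\lambda+1)}\partial/\partial f_k^{(\lambda)}$. Algorithm. Initial list: $f_1'$, $f_2',\dots,f_n'$, and for $2\le i\le n$, $2\le\lambda\le\kappa$ the invariants $\Lambda_{1,i}^3=[f_i',f_1']$,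 $\Lambda_{1,i;1^{\lambda-2}}^{2\lambda-1}=[\Lambda_{1,i;1^{\lambda-3}}^{2\lambda-3},f_1']$. One loop: given the current list $f_1',L_1,\dots,L_k$, compute for some monomial order a reduced Gröbner basis, made of weighted homogeneous elements ${\sf S}_i$, of the ideal of relations between $L_1|_0,\dots,L_k|_0$; write ${\sf S}_i(L_1,\dots,L_k)=(f_1')^{\nu_i}{\sf R}_i$ in $\mathbb{C}[j^\kappa f]$ with $\nu_i\ge1$ maximal (${\sf R}_i=0$ if the left side vanishes identically); each ${\sf R}_i$ is again an invariant; successively for $i=1,2,\dots$ append ${\sf R}_i$ to the list when it does not belong to the algebra generated by $f_1',L_1,\dots,L_k$ and the already appended ones. The algorithm terminates when a loop appends nothing. *)

theory Defs
  imports "HOL-Analysis.Analysis" "HOL-Library.Poly_Mapping"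
begin

section \<open>Polynomials over the complex numbers\<close>

text \<open>A monomial in the variables \<open>'x\<close> is identified with its exponent vector \<open>'x \<Rightarrow>\<^sub>0 nat\<close>; the
  ring operations on \<open>'x cpoly\<close> are those of \<^theory>\<open>HOL-Library.Poly_Mapping\<close>.\<close>

type_synonym 'x monom = "'x \<Rightarrow>\<^sub>0 nat"
type_synonym 'x cpoly = "'x monom \<Rightarrow>\<^sub>0 complex"

definition const :: "complex \<Rightarrow> 'x cpoly" where
  "const c = Poly_Mapping.single 0 c"

definition var :: "'x \<Rightarrow> 'x cpoly" where
  "var x = Poly_Mapping.single (Poly_Mapping.single x 1) 1"

definition monoms :: "'x set \<Rightarrow> 'x monom set" where
  "monoms V = {b. Poly_Mapping.keys b \<subseteq> V}"

definition poly_ring :: "'x set \<Rightarrow> 'x cpoly set" where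
  "poly_ring V = {p. Poly_Mapping.keys p \<subseteq> monoms V}"

definition poly_eval ::
    "(complex \<Rightarrow> 'a::comm_ring_1) \<Rightarrow> ('x \<Rightarrow> 'a) \<Rightarrow> 'x cpoly \<Rightarrow> 'a" where
  "poly_eval h g p = (\<Sum>b\<in>Poly_Mapping.keys p. h (Poly_Mapping.lookup p b) *
     (\<Prod>x\<in>Poly_Mapping.keys b. g x ^ Poly_Mapping.lookup b x))"

definition eval_at :: "('x \<Rightarrow> complex) \<Rightarrow> 'x cpoly \<Rightarrow> complex" where
  "eval_at = poly_eval (\<lambda>c. c)"

definition subst :: "('y \<Rightarrow> 'x cpoly) \<Rightarrow> 'y cpoly \<Rightarrow> 'x cpoly" where
  "subst = poly_eval const"

text \<open>Polynomials in \<open>A\<^sub>1, \<dots>, A\<^sub>k\<close> are elements of \<open>poly_ring {..<k}\<close>: the variable with index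
  \<open>j < k\<close> stands for \<open>A\<^bsub>j+1\<^esub>\<close>, and is replaced by the entry \<open>Ls ! j\<close>.\<close>

definition list_subst :: "'x cpoly list \<Rightarrow> nat cpoly \<Rightarrow> 'x cpoly" where
  "list_subst Ls S = subst (\<lambda>j. Ls ! j) S"

definition partial_deriv :: "'x \<Rightarrow> 'x cpoly \<Rightarrow> 'x cpoly" where
  "partial_deriv x p = (\<Sum>b\<in>Poly_Mapping.keys p.
     Poly_Mapping.single (b - Poly_Mapping.single x 1)
       (of_nat (Poly_Mapping.lookup b x) * Poly_Mapping.lookup p b))"

inductive_set generated_algebra :: "'x cpoly set \<Rightarrow> 'x cpoly set" for X :: "'x cpoly set" where
  const: "const c \<in> generated_algebra X"
| gen: "P \<in> X \<Longrightarrow> P \<in> generated_algebra X"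
| add: "P \<in> generated_algebra X \<Longrightarrow> Q \<in> generated_algebra X \<Longrightarrow> P + Q \<in> generated_algebra X"
| mult: "P \<in> generated_algebra X \<Longrightarrow> Q \<in> generated_algebra X \<Longrightarrow> P * Q \<in> generated_algebra X"

definition mutually_independent :: "'x cpoly list \<Rightarrow> bool" where
  "mutually_independent Ls \<longleftrightarrow>
     (\<forall>j<length Ls. Ls ! j \<notin> generated_algebra {Ls ! i |i. i < length Ls \<and> i \<noteq> j})"


section \<open>Groebner bases in finitely many variables\<close>

definition ideal_gen :: "nat \<Rightarrow> nat cpoly set \<Rightarrow> nat cpoly set" where
  "ideal_gen k X = {(\<Sum>s\<in>T. a s * s) |T a. finite T \<and> T \<subseteq> X \<and> (\<forall>s\<in>T. a s \<in> poly_ring {..<k})}"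

definition monomial_order :: "nat \<Rightarrow> (nat monom \<times> nat monom) set \<Rightarrow> bool" where
  "monomial_order k r \<longleftrightarrow> well_order_on (monoms {..<k}) r \<and>
     (\<forall>a b c. (a, b) \<in> r \<longrightarrow> c \<in> monoms {..<k} \<longrightarrow> (a + c, b + c) \<in> r)"

definition leading_monom :: "(nat monom \<times> nat monom) set \<Rightarrow> nat cpoly \<Rightarrow> nat monom" where
  "leading_monom r p = (THE b. b \<in> Poly_Mapping.keys p \<and> (\<forall>a\<in>Poly_Mapping.keys p. (a, b) \<in> r))"

definition leading_ideal ::
    "nat \<Rightarrow> (nat monom \<times> nat monom) set \<Rightarrow> nat cpoly set \<Rightarrow> nat cpoly set" where
  "leading_ideal k r X =
     ideal_gen k {Poly_Mapping.single (leading_monom r p) 1 |p. p \<in> X \<and> p \<noteq> 0}"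

text \<open>The set \<open>\<alpha> + \<nat>\<^sup>k\<close> of exponents of the monomials divisible by the monomial \<open>\<alpha>\<close>.\<close>

definition multiples :: "nat \<Rightarrow> nat monom \<Rightarrow> nat monom set" where
  "multiples k \<alpha> = {\<alpha> + c |c. c \<in> monoms {..<k}}"

definition reduced_groebner_basis ::
    "nat \<Rightarrow> (nat monom \<times> nat monom) set \<Rightarrow> nat cpoly set \<Rightarrow> nat cpoly set \<Rightarrow> bool" where
  "reduced_groebner_basis k r I G \<longleftrightarrow>
     finite G \<and> G \<subseteq> I \<and> 0 \<notin> G \<and> leading_ideal k r G = leading_ideal k r I \<and>
     (\<forall>p\<in>G. Poly_Mapping.lookup p (leading_monom r p) = 1 \<and>
        (\<forall>q\<in>G - {p}. \<forall>b\<in>Poly_Mapping.keys p. b \<notin> multiples k (leading_monom r q)))"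

definition monom_weight :: "nat list \<Rightarrow> nat monom \<Rightarrow> nat" where
  "monom_weight l b = (\<Sum>j\<in>Poly_Mapping.keys b. l ! j * Poly_Mapping.lookup b j)"

definition weighted_homogeneous :: "nat list \<Rightarrow> nat cpoly \<Rightarrow> bool" where
  "weighted_homogeneous l S \<longleftrightarrow> (\<exists>d. \<forall>b\<in>Poly_Mapping.keys S. monom_weight l b = d)"


section \<open>Jet polynomials and invariants by reparametrization\<close>

text \<open>The pair \<open>(i, \<lambda>)\<close> stands for the jet coordinate \<open>f\<^sub>i\<^bsup>(\<lambda>)\<^esup>\<close>. Jet orders are not bounded by the
  type, so that the total derivative is an operator on \<open>jet_poly\<close>.\<close>

type_synonym jet_poly = "(nat \<times> nat) cpoly"

definition jet_vars :: "nat \<Rightarrow> nat \<Rightarrow> (nat \<times> nat) set" where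
  "jet_vars n \<kappa> = {1..n} \<times> {1..\<kappa>}"

definition jet :: "(nat \<Rightarrow> complex \<Rightarrow> complex) \<Rightarrow> complex \<Rightarrow> nat \<times> nat \<Rightarrow> complex" where
  "jet f \<zeta> = (\<lambda>(i, s). (deriv ^^ s) (f i) \<zeta>)"

definition invariants :: "nat \<Rightarrow> nat \<Rightarrow> nat \<Rightarrow> jet_poly set" where
  "invariants n \<kappa> m = {P \<in> poly_ring (jet_vars n \<kappa>).
     \<forall>f \<phi>. (\<forall>i\<in>{1..n}. f i analytic_on {0}) \<longrightarrow>
       \<phi> analytic_on {0} \<longrightarrow> \<phi> 0 = 0 \<longrightarrow> deriv \<phi> 0 \<noteq> 0 \<longrightarrow>
       (\<forall>\<^sub>F \<zeta> in nhds 0.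
          eval_at (jet (\<lambda>i. f i \<circ> \<phi>) \<zeta>) P = deriv \<phi> \<zeta> ^ m * eval_at (jet f (\<phi> \<zeta>)) P)}"

definition invariant_algebra :: "nat \<Rightarrow> nat \<Rightarrow> jet_poly set" where
  "invariant_algebra n \<kappa> = {(\<Sum>m\<le>d. P m) |d P. \<forall>m\<le>d. P m \<in> invariants n \<kappa> m}"

definition total_deriv :: "jet_poly \<Rightarrow> jet_poly" where
  "total_deriv P = (\<Sum>(k, s) \<in> (\<Union>b\<in>Poly_Mapping.keys P. Poly_Mapping.keys b).
     var (k, Suc s) * partial_deriv (k, s) P)"

text \<open>\<open>bracket p P q Q\<close> is \<open>[P, Q]\<close> for invariants \<open>P\<close>, \<open>Q\<close> of weights \<open>p\<close>, \<open>q\<close>.\<close>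

definition bracket :: "nat \<Rightarrow> jet_poly \<Rightarrow> nat \<Rightarrow> jet_poly \<Rightarrow> jet_poly" where
  "bracket p P q Q = of_nat q * total_deriv P * Q - of_nat p * P * total_deriv Q"

definition f1' :: jet_poly where
  "f1' = var (1, 1)"

definition restrict0 :: "jet_poly \<Rightarrow> jet_poly" where
  "restrict0 P = subst (\<lambda>x. if x = (1, 1) then 0 else var x) P"


section \<open>The algorithm generating invariants\<close>

text \<open>\<open>Lambda i t\<close> is \<open>f\<^sub>i'\<close> for \<open>t = 0\<close> and, for \<open>t = \<lambda> - 1 \<ge> 1\<close>, the invariant
  \<open>\<Lambda>\<^bsub>1,i;1\<^esub>\<dots>\<close> (with \<open>\<lambda> - 2\<close> trailing indices 1) of weight \<open>2 \<lambda> - 1 = 2 t + 1\<close>.\<close>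

primrec Lambda :: "nat \<Rightarrow> nat \<Rightarrow> jet_poly" where
  "Lambda i 0 = var (i, 1)"
| "Lambda i (Suc t) = bracket (2 * t + 1) (Lambda i t) 1 f1'"

text \<open>The lists below never contain the first member \<open>f\<^sub>1'\<close>, which is always understood.\<close>

definition initial_list :: "nat \<Rightarrow> nat \<Rightarrow> jet_poly list" where
  "initial_list n \<kappa> = map (\<lambda>i. var (i, 1)) [2..<n + 1] @
     concat (map (\<lambda>i. map (\<lambda>s. Lambda i (s - 1)) [2..<\<kappa> + 1]) [2..<n + 1])"

definition relations0 :: "jet_poly list \<Rightarrow> nat cpoly set" where
  "relations0 L = {S \<in> poly_ring {..<length L}. list_subst (map restrict0 L) S = 0}"

definition has_weights :: "nat \<Rightarrow> nat \<Rightarrow> jet_poly list \<Rightarrow> nat list \<Rightarrow> bool" where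
  "has_weights n \<kappa> L l \<longleftrightarrow>
     length l = length L \<and> (\<forall>j<length L. L ! j \<in> invariants n \<kappa> (l ! j))"

definition homogeneous_reduced_basis ::
    "jet_poly list \<Rightarrow> nat list \<Rightarrow> (nat monom \<times> nat monom) set \<Rightarrow> nat cpoly list \<Rightarrow> bool" where
  "homogeneous_reduced_basis L l r Ss \<longleftrightarrow>
     monomial_order (length L) r \<and> distinct Ss \<and>
     reduced_groebner_basis (length L) r (relations0 L) (set Ss) \<and>
     (\<forall>S\<in>set Ss. weighted_homogeneous l S)"

definition f1'_quotient :: "jet_poly \<Rightarrow> jet_poly \<Rightarrow> bool" where
  "f1'_quotient Q R \<longleftrightarrow> (if Q = 0 then R = 0 else
     (\<exists>\<nu>\<ge>1. Q = f1' ^ \<nu> * R \<and> (\<forall>\<mu>. f1' ^ \<mu> dvd Q \<longrightarrow> \<mu> \<le> \<nu>)))"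

primrec append_new :: "jet_poly list \<Rightarrow> jet_poly list \<Rightarrow> jet_poly list" where
  "append_new L [] = L"
| "append_new L (R # Rs) =
     append_new (if R \<in> generated_algebra (set (f1' # L)) then L else L @ [R]) Rs"

text \<open>A loop depends on the chosen monomial order and on the enumeration of the basis, so it is
  a relation between the current list and the next one.\<close>

definition alg_loop :: "nat \<Rightarrow> nat \<Rightarrow> jet_poly list \<Rightarrow> jet_poly list \<Rightarrow> bool" where
  "alg_loop n \<kappa> L L' \<longleftrightarrow>
     (\<exists>l r Ss Rs. has_weights n \<kappa> L l \<and> homogeneous_reduced_basis L l r Ss \<and>
        list_all2 (\<lambda>S R. f1'_quotient (list_subst L S) R) Ss Rs \<and> L' = append_new L Rs)"

text \<open>The algorithm terminates at \<open>L\<close>: the next loop can be performed and, whatever choices are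
  made in it, it appends nothing.\<close>

definition terminates_at :: "nat \<Rightarrow> nat \<Rightarrow> jet_poly list \<Rightarrow> bool" where
  "terminates_at n \<kappa> L \<longleftrightarrow>
     (\<exists>L'. alg_loop n \<kappa> L L') \<and> (\<forall>L'. alg_loop n \<kappa> L L' \<longrightarrow> L' = L)"


section \<open>Normal forms\<close>

definition normal_exponents ::
    "nat list \<Rightarrow> (nat monom \<times> nat monom) set \<Rightarrow> nat cpoly list \<Rightarrow> nat \<Rightarrow> nat monom set" where
  "normal_exponents l r Ss d =
     {b \<in> monoms {..<length l} - (\<Union>S\<in>set Ss. multiples (length l) (leading_monom r S)).
        monom_weight l b = d}"

definition normal_sum ::
    "jet_poly list \<Rightarrow> nat list \<Rightarrow> (nat monom \<times> nat monom) set \<Rightarrow> nat cpoly list \<Rightarrow>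
     nat \<Rightarrow> (nat \<Rightarrow> nat monom \<Rightarrow> complex) \<Rightarrow> jet_poly" where
  "normal_sum L l r Ss m cf =
     (\<Sum>a\<le>m. f1' ^ a * (\<Sum>b\<in>normal_exponents l r Ss (m - a).
        const (cf a b) * (\<Prod>j<length L. (L ! j) ^ Poly_Mapping.lookup b j)))"

end

theory Submission
  imports Defs "HOL-Complex_Analysis.Complex_Analysis"
begin

text \<open>
  Reparametrizing by the inverse of \<open>f\<^sub>1\<close> expresses an invariant, up to powers of \<open>f\<^sub>1'\<close>, as a
  polynomial in the initial list; so \<open>(f\<^sub>1')\<^sup>N P\<close> lies in the algebra \<open>\<A>\<close> generated by the list, for
  some \<open>N\<close>. If \<open>f\<^sub>1' Q = S(\<Lambda>) + f\<^sub>1' T\<close> is in \<open>\<A>\<close>, then restricting to \<open>f\<^sub>1' = 0\<close> shows that \<open>S\<close> is a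
  relation, hence a combination of the \<open>S\<^sub>i\<close>, and by hypothesis \<open>S(\<Lambda>)\<close> is \<open>f\<^sub>1'\<close> times an
  element of \<open>\<A>\<close>; therefore \<open>Q \<in> \<A>\<close>, and the powers of \<open>f\<^sub>1'\<close> can be removed one by one. The
  normal form is obtained by induction on the weight: the restriction of an invariant to \<open>f\<^sub>1' = 0\<close>
  has a unique Groebner normal form, and the difference is \<open>f\<^sub>1'\<close> times an invariant of weight
  \<open>m - 1\<close>. Polynomial identities are checked by evaluation at points with nonzero coordinates.
\<close>

section \<open>Evaluation of polynomials\<close>

text \<open>The closing relations concern only the basis elements, whereas removing a power of
  \<open>f1'\<close> needs every relation. The division algorithm bridges this gap; it is proved
  relative to an abstract set of remainders, so that it yields both generation of the ideal and
  normal forms. Analysis enters mainly through well-chosen reparametrizations. Dilations give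
  homogeneity. The local inverse of the first component exists only where \<open>f1'\<close> is
  nonzero, which is the origin of the powers of \<open>f1'\<close> in denominators. Removing them
  takes place in the algebra; its twin, that \<open>Q\<close> is an invariant when
  \<open>f1' * Q\<close> is, lets the normal form descend in weight, and there the zeros of
  \<open>f1'\<close> require a limit. Mutual independence excludes constants from the list. Hence
  all weights are positive, and each weight admits only finitely many exponents.\<close>

definition monom_eval :: "('x \<Rightarrow> 'a::comm_semiring_1) \<Rightarrow> 'x monom \<Rightarrow> 'a" where
  "monom_eval z b = (\<Prod>x\<in>Poly_Mapping.keys b. z x ^ Poly_Mapping.lookup b x)"

lemma monom_eval_superset:
  assumes "finite X" "Poly_Mapping.keys b \<subseteq> X"
  shows "monom_eval z b = (\<Prod>x\<in>X. z x ^ Poly_Mapping.lookup b x)"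
  unfolding monom_eval_def
  by (rule prod.mono_neutral_left) (use assms in \<open>auto simp: in_keys_iff\<close>)

lemma monom_eval_add: "monom_eval z (a + b) = monom_eval z a * monom_eval z b"
proof -
  let ?X = "Poly_Mapping.keys a \<union> Poly_Mapping.keys b"
  have "Poly_Mapping.keys (a + b) \<subseteq> ?X" by (rule keys_add)
  then have "monom_eval z (a + b) = (\<Prod>x\<in>?X. z x ^ Poly_Mapping.lookup (a + b) x)"
    by (intro monom_eval_superset) auto
  also have "\<dots> = (\<Prod>x\<in>?X. z x ^ Poly_Mapping.lookup a x) * (\<Prod>x\<in>?X. z x ^ Poly_Mapping.lookup b x)"
    by (simp add: lookup_add power_add prod.distrib)
  also have "\<dots> = monom_eval z a * monom_eval z b"
    by (simp add: monom_eval_superset[of ?X])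
  finally show ?thesis .
qed

lemma monom_eval_0 [simp]: "monom_eval z 0 = 1"
  by (simp add: monom_eval_def)

lemma monom_eval_single [simp]: "monom_eval z (Poly_Mapping.single x k) = z x ^ k"
  by (cases "k = 0") (auto simp: monom_eval_def)

lemma eval_at_superset:
  assumes "finite B" "Poly_Mapping.keys p \<subseteq> B"
  shows "eval_at z p = (\<Sum>b\<in>B. Poly_Mapping.lookup p b * monom_eval z b)"
  unfolding eval_at_def poly_eval_def monom_eval_def[symmetric]
  by (rule sum.mono_neutral_left) (use assms in \<open>auto simp: in_keys_iff\<close>)

lemma eval_at_eq:
  "eval_at z p = (\<Sum>b\<in>Poly_Mapping.keys p. Poly_Mapping.lookup p b * monom_eval z b)"
  by (rule eval_at_superset) auto

lemma eval_at_0 [simp]: "eval_at z 0 = 0"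
  by (simp add: eval_at_eq)

lemma eval_at_single [simp]: "eval_at z (Poly_Mapping.single b c) = c * monom_eval z b"
  by (subst eval_at_superset[of "{b}"]) (auto simp: lookup_single)

lemma eval_at_const [simp]: "eval_at z (const c) = c"
  by (simp add: const_def)

lemma eval_at_var [simp]: "eval_at z (var x) = z x"
  by (simp add: var_def)

lemma eval_at_1 [simp]: "eval_at z 1 = 1"
  using eval_at_single[of z 0 1] by (simp add: single_one del: eval_at_single)

lemma eval_at_add [simp]: "eval_at z (p + q) = eval_at z p + eval_at z q"
proof -
  let ?B = "Poly_Mapping.keys p \<union> Poly_Mapping.keys q"
  have "eval_at z (p + q) = (\<Sum>b\<in>?B. Poly_Mapping.lookup (p + q) b * monom_eval z b)"
    by (rule eval_at_superset) (use keys_add[of p q] in auto)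
  then show ?thesis
    by (simp add: lookup_add distrib_right sum.distrib eval_at_superset[of ?B])
qed

lemma eval_at_uminus [simp]: "eval_at z (- p) = - eval_at z p"
  using eval_at_add[of z p "- p"] by (simp add: add_eq_0_iff del: eval_at_add)

lemma eval_at_diff [simp]: "eval_at z (p - q) = eval_at z p - eval_at z q"
  using eval_at_add[of z p "- q"] by (simp del: eval_at_add)

lemma eval_at_sum [simp]: "eval_at z (sum p I) = (\<Sum>i\<in>I. eval_at z (p i))"
  by (induction I rule: infinite_finite_induct) auto

lemma sum_singles:
  "(p :: 'x cpoly) = (\<Sum>b\<in>Poly_Mapping.keys p. Poly_Mapping.single b (Poly_Mapping.lookup p b))"
  by (rule poly_mapping_eqI)
     (auto simp: lookup_sum lookup_single when_def in_keys_iff if_distrib cong: if_cong)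

lemma eval_at_mult [simp]: "eval_at z (p * q) = eval_at z p * eval_at z q"
proof -
  let ?s = "\<lambda>p b. Poly_Mapping.single b (Poly_Mapping.lookup p b)"
  have "eval_at z (p * q) =
    eval_at z ((\<Sum>a\<in>Poly_Mapping.keys p. ?s p a) * (\<Sum>b\<in>Poly_Mapping.keys q. ?s q b))"
    by (simp flip: sum_singles)
  also have "\<dots> = eval_at z (\<Sum>a\<in>Poly_Mapping.keys p. ?s p a) * eval_at z (\<Sum>b\<in>Poly_Mapping.keys q. ?s q b)"
    by (simp add: sum_product mult_single monom_eval_add mult_ac)
  finally show ?thesis by (simp flip: sum_singles)
qed

lemma eval_at_of_nat [simp]: "eval_at z (of_nat k) = of_nat k"
  by (induction k) auto

lemma eval_at_power [simp]: "eval_at z (p ^ k) = eval_at z p ^ k"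
  by (induction k) auto

lemma eval_at_prod [simp]: "eval_at z (prod p I) = (\<Prod>i\<in>I. eval_at z (p i))"
  by (induction I rule: infinite_finite_induct) auto

lemma eval_at_monom_eval [simp]: "eval_at z (monom_eval g b) = monom_eval (\<lambda>x. eval_at z (g x)) b"
  by (simp add: monom_eval_def)

lemma eval_at_subst [simp]: "eval_at z (subst g p) = eval_at (\<lambda>x. eval_at z (g x)) p"
  unfolding subst_def poly_eval_def monom_eval_def[symmetric] eval_at_sum eval_at_mult
    eval_at_monom_eval eval_at_const
  by (simp add: eval_at_eq[of _ p])

lemma eval_at_cong:
  assumes "p \<in> poly_ring V" "\<And>x. x \<in> V \<Longrightarrow> z x = z' x"
  shows "eval_at z p = eval_at z' p"
  unfolding eval_at_eq monom_eval_def
proof (intro sum.cong prod.cong refl arg_cong2[where f="(*)"])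
  fix b x assume "b \<in> Poly_Mapping.keys p" "x \<in> Poly_Mapping.keys b"
  then have "x \<in> V" using assms(1) by (auto simp: poly_ring_def monoms_def)
  then show "z x ^ Poly_Mapping.lookup b x = z' x ^ Poly_Mapping.lookup b x"
    using assms(2) by simp
qed

text \<open>Dedekind's argument: distinct monomials are distinct characters of the torus.\<close>

lemma monom_eval_independent:
  fixes c :: "'x monom \<Rightarrow> complex"
  assumes "finite B" "\<And>z. (\<And>x. z x \<noteq> 0) \<Longrightarrow> (\<Sum>b\<in>B. c b * monom_eval z b) = 0"
  shows "\<forall>b\<in>B. c b = 0"
  using assms
proof (induction B arbitrary: c rule: finite_induct)
  case empty
  then show ?case by simp
next
  case (insert b' B)
  \<comment> \<open>Doubling the coordinate \<open>x\<close> multiplies each monomial by a power of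
    2; subtracting the original relation, scaled by the power belonging to \<open>b'\<close>,
    eliminates \<open>b'\<close>. The number 2 serves because its powers are distinct.\<close>
  have *: "c b * (2 ^ Poly_Mapping.lookup b x - 2 ^ Poly_Mapping.lookup b' x) = 0"
    if "b \<in> B" for b x
  proof -
    have "\<forall>b\<in>B. c b * (2 ^ Poly_Mapping.lookup b x - 2 ^ Poly_Mapping.lookup b' x) = 0"
    proof (rule insert.IH)
      fix z :: "'x \<Rightarrow> complex" assume z: "\<And>x. z x \<noteq> 0"
      let ?z = "\<lambda>y. (if y = x then 2 else 1) * z y"
      have me: "monom_eval ?z b = 2 ^ Poly_Mapping.lookup b x * monom_eval z b" for b
      proof -
        have "monom_eval ?z b = monom_eval (\<lambda>y. if y = x then 2 else 1) b * monom_eval z b"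
          by (simp add: monom_eval_def power_mult_distrib prod.distrib)
        also have "monom_eval (\<lambda>y. if y = x then 2 else (1::complex)) b =
            (\<Prod>y\<in>insert x (Poly_Mapping.keys b). if y = x then 2 ^ Poly_Mapping.lookup b y else 1)"
          by (rule trans[OF monom_eval_superset[of "insert x (Poly_Mapping.keys b)"] prod.cong]) auto
        also have "\<dots> = 2 ^ Poly_Mapping.lookup b x" by (subst prod.delta) auto
        finally show ?thesis .
      qed
      have "(\<Sum>b\<in>insert b' B. c b * monom_eval ?z b) = 0"
        using z by (intro insert.prems) auto
      moreover have "2 ^ Poly_Mapping.lookup b' x * (\<Sum>b\<in>insert b' B. c b * monom_eval z b) = 0"
        using z by (subst insert.prems) auto
      ultimately have "(\<Sum>b\<in>insert b' B. c b * monom_eval ?z b) -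
         2 ^ Poly_Mapping.lookup b' x * (\<Sum>b\<in>insert b' B. c b * monom_eval z b) = 0" by simp
      then show "(\<Sum>b\<in>B. c b * (2 ^ Poly_Mapping.lookup b x - 2 ^ Poly_Mapping.lookup b' x) *
          monom_eval z b) = 0"
        using insert.hyps unfolding me
        by (simp add: algebra_simps sum_distrib_left sum_subtractf)
    qed
    then show ?thesis using that by blast
  qed
  have B: "c b = 0" if "b \<in> B" for b
  proof -
    have "b \<noteq> b'" using that insert.hyps by auto
    then obtain x where x: "Poly_Mapping.lookup b x \<noteq> Poly_Mapping.lookup b' x"
      by (metis poly_mapping_eqI)
    have "(2::complex) ^ Poly_Mapping.lookup b x \<noteq> 2 ^ Poly_Mapping.lookup b' x"
    proof
      assume "(2::complex) ^ Poly_Mapping.lookup b x = 2 ^ Poly_Mapping.lookup b' x"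
      then have "cmod (2 ^ Poly_Mapping.lookup b x) = cmod (2 ^ Poly_Mapping.lookup b' x)" by simp
      then show False using x by (simp add: norm_power)
    qed
    then show ?thesis using *[OF that, of x] by simp
  qed
  have "(\<Sum>b\<in>insert b' B. c b * monom_eval (\<lambda>_. 1) b) = 0"
    by (rule insert.prems) auto
  then have "c b' = 0" using insert.hyps B by (simp add: monom_eval_def)
  then show ?case using B by auto
qed

text \<open>Testing only nonzero coordinates allows division by \<open>z (1, 1)\<close>, as in
  \<open>f1'_cancel\<close>, and the use of identities that hold only where \<open>f1'\<close> is
  invertible.\<close>

lemma eval_at_inject:
  assumes "\<And>z. (\<And>x. z x \<noteq> 0) \<Longrightarrow> eval_at z p = eval_at z q"
  shows "p = q"
proof -
  have "\<forall>b\<in>Poly_Mapping.keys (p - q). Poly_Mapping.lookup (p - q) b = 0"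
  proof (rule monom_eval_independent)
    fix z :: "'a \<Rightarrow> complex" assume "\<And>x. z x \<noteq> 0"
    then have "eval_at z (p - q) = 0" using assms by simp
    then show "(\<Sum>b\<in>Poly_Mapping.keys (p - q). Poly_Mapping.lookup (p - q) b * monom_eval z b) = 0"
      by (simp add: eval_at_eq)
  qed auto
  then have "p - q = 0" by (metis in_keys_iff lookup_zero poly_mapping_eqI)
  then show ?thesis by simp
qed

section \<open>Polynomial rings and generated algebras\<close>

text \<open>The homomorphism laws of \<open>subst\<close> are inherited from \<open>eval_at\<close>,
  since evaluations separate polynomials.\<close>

lemma subst_add: "subst g (p + q) = subst g p + subst g q"
  by (rule eval_at_inject) simp

lemma subst_diff: "subst g (p - q) = subst g p - subst g q"
  by (rule eval_at_inject) simp

lemma subst_mult: "subst g (p * q) = subst g p * subst g q"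
  by (rule eval_at_inject) simp

lemma subst_sum: "subst g (sum p I) = (\<Sum>i\<in>I. subst g (p i))"
  by (rule eval_at_inject) simp

lemma subst_const [simp]: "subst g (const c) = const c"
  by (rule eval_at_inject) simp

lemma subst_0 [simp]: "subst g 0 = 0"
  by (rule eval_at_inject) simp

lemma subst_var [simp]: "subst g (var x) = g x"
  by (rule eval_at_inject) simp

lemma subst_single: "subst g (Poly_Mapping.single b c) = const c * monom_eval g b"
  by (rule eval_at_inject) simp

lemma const_0 [simp]: "const 0 = 0"
  by (simp add: const_def)

lemma const_1 [simp]: "const 1 = 1"
  by (simp add: const_def single_one)

lemma monoms_add: "a \<in> monoms V \<Longrightarrow> b \<in> monoms V \<Longrightarrow> a + b \<in> monoms V"
  using keys_add[of a b] by (auto simp: monoms_def)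

lemma poly_ring_0 [simp]: "0 \<in> poly_ring V"
  by (simp add: poly_ring_def)

lemma poly_ring_single: "b \<in> monoms V \<Longrightarrow> Poly_Mapping.single b c \<in> poly_ring V"
  by (simp add: poly_ring_def)

lemma poly_ring_const [simp]: "const c \<in> poly_ring V"
  by (simp add: const_def poly_ring_single monoms_def)

lemma poly_ring_1 [simp]: "1 \<in> poly_ring V"
  by (metis const_1 poly_ring_const)

lemma poly_ring_var [simp]: "x \<in> V \<Longrightarrow> var x \<in> poly_ring V"
  by (simp add: var_def poly_ring_single monoms_def)

lemma poly_ring_add: "p \<in> poly_ring V \<Longrightarrow> q \<in> poly_ring V \<Longrightarrow> p + q \<in> poly_ring V"
  using keys_add[of p q] by (auto simp: poly_ring_def)

lemma poly_ring_uminus: "p \<in> poly_ring V \<Longrightarrow> - p \<in> poly_ring V"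
  by (auto simp: poly_ring_def in_keys_iff subset_iff)

lemma poly_ring_diff: "p \<in> poly_ring V \<Longrightarrow> q \<in> poly_ring V \<Longrightarrow> p - q \<in> poly_ring V"
  using poly_ring_add[of p V "- q"] poly_ring_uminus[of q V] by simp

lemma poly_ring_mult:
  assumes "p \<in> poly_ring V" "q \<in> poly_ring V"
  shows "p * q \<in> poly_ring V"
proof -
  have "b \<in> monoms V" if "b \<in> Poly_Mapping.keys (p * q)" for b
  proof -
    obtain a c where "b = a + c" "a \<in> Poly_Mapping.keys p" "c \<in> Poly_Mapping.keys q"
      using \<open>b \<in> _\<close> keys_mult[of p q] by blast
    then show ?thesis using assms by (auto simp: poly_ring_def intro!: monoms_add)
  qed
  then show ?thesis by (auto simp: poly_ring_def)
qed

lemma poly_ring_sum: "(\<And>i. i \<in> I \<Longrightarrow> p i \<in> poly_ring V) \<Longrightarrow> sum p I \<in> poly_ring V"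
  by (induction I rule: infinite_finite_induct) (auto intro: poly_ring_add)

lemma generated_algebra_0: "0 \<in> generated_algebra X"
  by (metis const_0 generated_algebra.const)

lemma generated_algebra_power: "P \<in> generated_algebra X \<Longrightarrow> P ^ k \<in> generated_algebra X"
proof (induction k)
  case 0
  then show ?case by (metis const_1 generated_algebra.const power_0)
qed (auto intro: generated_algebra.mult)

lemma generated_algebra_sum:
  "(\<And>i. i \<in> I \<Longrightarrow> P i \<in> generated_algebra X) \<Longrightarrow> sum P I \<in> generated_algebra X"
  by (induction I rule: infinite_finite_induct)
     (auto intro: generated_algebra_0 generated_algebra.add)

lemma generated_algebra_prod:
  "(\<And>i. i \<in> I \<Longrightarrow> P i \<in> generated_algebra X) \<Longrightarrow> prod P I \<in> generated_algebra X"
proof (induction I rule: infinite_finite_induct)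
  case (insert x F)
  then show ?case by (auto intro: generated_algebra.mult)
qed (metis const_1 generated_algebra.const prod.infinite prod.empty)+

lemma subst_in_generated_algebra:
  assumes "p \<in> poly_ring V"
  shows "subst g p \<in> generated_algebra (g ` V)"
  unfolding subst_def poly_eval_def
proof (intro generated_algebra_sum generated_algebra.mult generated_algebra.const
    generated_algebra_prod generated_algebra_power generated_algebra.gen)
  fix b x assume "b \<in> Poly_Mapping.keys p" "x \<in> Poly_Mapping.keys b"
  then show "g x \<in> g ` V" using assms by (auto simp: poly_ring_def monoms_def)
qed

text \<open>Provides structural induction over polynomials: constants, variables, sums and
  products.\<close>

lemma poly_ring_eq_generated_algebra: "poly_ring V = generated_algebra (var ` V)"
proof (intro equalityI subsetI)
  fix p :: "'a cpoly" assume p: "p \<in> poly_ring V"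
  have "subst var p = p" by (rule eval_at_inject) simp
  then show "p \<in> generated_algebra (var ` V)" using subst_in_generated_algebra[OF p, of var] by simp
next
  fix p :: "'a cpoly" assume "p \<in> generated_algebra (var ` V)"
  then show "p \<in> poly_ring V"
    by induction (auto intro: poly_ring_add poly_ring_mult)
qed

section \<open>Restriction to the hyperplane where the first derivative vanishes\<close>

lemma eval_at_restrict0 [simp]: "eval_at z (restrict0 P) = eval_at (z((1, 1) := 0)) P"
  unfolding restrict0_def eval_at_subst by (rule arg_cong[where f="\<lambda>g. eval_at g P"]) auto

lemma restrict0_add: "restrict0 (P + Q) = restrict0 P + restrict0 Q"
  by (simp add: restrict0_def subst_add)

lemma restrict0_mult: "restrict0 (P * Q) = restrict0 P * restrict0 Q"
  by (simp add: restrict0_def subst_mult)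

lemma eval_at_f1' [simp]: "eval_at z f1' = z (1, 1)"
  by (simp add: f1'_def)

lemma restrict0_f1' [simp]: "restrict0 f1' = 0"
  by (simp add: restrict0_def f1'_def)

lemma f1'_cancel:
  assumes "f1' * P = f1' * Q"
  shows "P = Q"
proof (rule eval_at_inject)
  fix z :: "nat \<times> nat \<Rightarrow> complex" assume z: "\<And>x. z x \<noteq> 0"
  have "eval_at z (f1' * P) = eval_at z (f1' * Q)" using assms by simp
  then show "eval_at z P = eval_at z Q" using z by simp
qed

text \<open>The quotient is kept inside \<open>poly_ring V\<close> because
  \<open>invariants_divide_f1'\<close> asks for a polynomial in the jet variables.\<close>

lemma f1'_divides_diff_restrict0:
  assumes "P \<in> poly_ring V"
  shows "\<exists>Q\<in>poly_ring V. restrict0 P \<in> poly_ring V \<and> P = restrict0 P + f1' * Q"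
  using assms[unfolded poly_ring_eq_generated_algebra]
proof (induction rule: generated_algebra.induct)
  case (const c)
  then show ?case by (intro bexI[of _ 0]) (auto simp: restrict0_def)
next
  case (gen P)
  then obtain x where x: "P = var x" "x \<in> V" by auto
  show ?case
  proof (cases "x = (1, 1)")
    case True
    then show ?thesis using x by (intro bexI[of _ 1]) (auto simp: restrict0_def f1'_def)
  next
    case False
    then show ?thesis using x by (intro bexI[of _ 0]) (auto simp: restrict0_def)
  qed
next
  case (add P Q)
  then obtain P' Q' where P: "P' \<in> poly_ring V" "P = restrict0 P + f1' * P'"
    and Q: "Q' \<in> poly_ring V" "Q = restrict0 Q + f1' * Q'"
    and r: "restrict0 P \<in> poly_ring V" "restrict0 Q \<in> poly_ring V" by blast
  have "P + Q = restrict0 (P + Q) + f1' * (P' + Q')"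
    by (subst P(2), subst Q(2)) (simp add: restrict0_add algebra_simps)
  then show ?case using P(1) Q(1) r
    unfolding restrict0_add by (intro bexI[of _ "P' + Q'"] conjI poly_ring_add)
next
  case (mult P Q)
  then obtain P' Q' where P: "P' \<in> poly_ring V" "P = restrict0 P + f1' * P'"
    and Q: "Q' \<in> poly_ring V" "Q = restrict0 Q + f1' * Q'"
    and r: "restrict0 P \<in> poly_ring V" "restrict0 Q \<in> poly_ring V" by blast
  \<comment> \<open>The discrete product rule: first \<open>P\<close>, then \<open>Q\<close>, is
    replaced by its restriction.\<close>
  have "P * Q = restrict0 (P * Q) + f1' * (restrict0 P * Q' + P' * Q)"
  proof -
    have "P * Q = restrict0 P * Q + f1' * (P' * Q)"
      by (subst P(2)) (simp add: algebra_simps)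
    also have "restrict0 P * Q = restrict0 P * (restrict0 Q + f1' * Q')"
      using Q(2) by simp
    finally show ?thesis unfolding restrict0_mult by (simp only: algebra_simps)
  qed
  then show ?case using P(1) Q(1) r mult.hyps[folded poly_ring_eq_generated_algebra]
    unfolding restrict0_mult
    by (intro bexI[of _ "restrict0 P * Q' + P' * Q"] conjI poly_ring_add poly_ring_mult)
qed

section \<open>Division by a Groebner basis\<close>

lemma linear_order_on_finite_max:
  assumes "linear_order_on M r" "finite A" "A \<noteq> {}" "A \<subseteq> M"
  shows "\<exists>b\<in>A. \<forall>a\<in>A. (a, b) \<in> r"
  using assms(2-4)
proof (induction rule: finite_ne_induct)
  case (singleton x)
  then show ?case
    using assms(1) by (auto simp: order_on_defs refl_on_def)
next
  case (insert x F)
  then obtain b where b: "b \<in> F" "\<forall>a\<in>F. (a, b) \<in> r" by auto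
  have r: "trans r" "(x, x) \<in> r" "(x, b) \<in> r \<or> (b, x) \<in> r"
    using assms(1) insert.prems b(1) insert.hyps
    by (auto simp: order_on_defs refl_on_def total_on_def)
  from r(3) show ?case
  proof
    assume "(b, x) \<in> r"
    then show ?thesis using b r by (intro bexI[of _ x]) (auto dest: transD)
  qed (use b in auto)
qed

lemma leading_monom_max:
  assumes "monomial_order k r" "p \<in> poly_ring {..<k}" "p \<noteq> 0"
  shows "leading_monom r p \<in> Poly_Mapping.keys p"
    and "\<And>a. a \<in> Poly_Mapping.keys p \<Longrightarrow> (a, leading_monom r p) \<in> r"
proof -
  have lin: "linear_order_on (monoms {..<k}) r"
    using assms(1) by (auto simp: monomial_order_def well_order_on_def)
  have "\<exists>b. b \<in> Poly_Mapping.keys p \<and> (\<forall>a\<in>Poly_Mapping.keys p. (a, b) \<in> r)"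
    using linear_order_on_finite_max[OF lin, of "Poly_Mapping.keys p"] assms(2,3)
    by (auto simp: poly_ring_def)
  moreover have "antisym r" using lin by (auto simp: order_on_defs)
  ultimately have "\<exists>!b. b \<in> Poly_Mapping.keys p \<and> (\<forall>a\<in>Poly_Mapping.keys p. (a, b) \<in> r)"
    by (auto dest: antisymD)
  from theI'[OF this]
  show "leading_monom r p \<in> Poly_Mapping.keys p"
    and "\<And>a. a \<in> Poly_Mapping.keys p \<Longrightarrow> (a, leading_monom r p) \<in> r"
    by (auto simp: leading_monom_def)
qed

text \<open>An exponent occurring in a combination of monomials occurs in one of the summands, hence
  is a multiple of one generator.\<close>

lemma leading_monom_in_multiples:
  assumes "reduced_groebner_basis k r I G" "p \<in> I" "p \<noteq> 0"
  shows "\<exists>S\<in>G. leading_monom r p \<in> multiples k (leading_monom r S)"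
proof -
  let ?lt = "\<lambda>p. Poly_Mapping.single (leading_monom r p) (1::complex)"
  have "?lt p = (\<Sum>s\<in>{?lt p}. 1 * s)" by simp
  then have "?lt p \<in> leading_ideal k r I"
    unfolding leading_ideal_def ideal_gen_def using assms(2,3)
    by (intro CollectI exI[of _ "{?lt p}"] exI[of _ "\<lambda>_. 1"]) auto
  then have "?lt p \<in> leading_ideal k r G"
    using assms(1) by (simp add: reduced_groebner_basis_def)
  then obtain T a where T: "?lt p = (\<Sum>s\<in>T. a s * s)" "T \<subseteq> {?lt p |p. p \<in> G \<and> p \<noteq> 0}"
    and a: "\<forall>s\<in>T. a s \<in> poly_ring {..<k}"
    unfolding leading_ideal_def ideal_gen_def by blast
  have "leading_monom r p \<in> Poly_Mapping.keys (\<Sum>s\<in>T. a s * s)"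
    by (simp flip: T(1))
  then obtain s where s: "s \<in> T" "leading_monom r p \<in> Poly_Mapping.keys (a s * s)"
    using keys_sum[of "\<lambda>s. a s * s" T] by blast
  then obtain S where S: "S \<in> G" "s = ?lt S" using T(2) by auto
  obtain c where c: "c \<in> Poly_Mapping.keys (a s)" "leading_monom r p = c + leading_monom r S"
    using s(2) keys_mult[of "a s" s] by (auto simp: S(2))
  have "c \<in> monoms {..<k}" using a s(1) c(1) by (auto simp: poly_ring_def)
  then show ?thesis
    using S(1) c(2) by (auto simp: multiples_def add.commute intro!: bexI[of _ S])
qed

text \<open>The set \<open>J\<close> abstracts what division may discard. With the relations it
  gives normal forms of restrictions; with a smaller set closed under the same operations it proves
  that the basis generates the ideal.\<close>

lemma normal_form_exists:
  assumes ord: "monomial_order k r"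
    and G: "G \<subseteq> poly_ring {..<k}" "\<And>S. S \<in> G \<Longrightarrow> Poly_Mapping.lookup S (leading_monom r S) = 1"
    and J: "0 \<in> J" "\<And>p q. p \<in> J \<Longrightarrow> q \<in> J \<Longrightarrow> p + q \<in> J"
      "\<And>S p. S \<in> G \<Longrightarrow> p \<in> poly_ring {..<k} \<Longrightarrow> p * S \<in> J"
    and q: "q \<in> poly_ring {..<k}"
  shows "\<exists>N. Poly_Mapping.keys N \<subseteq>
      monoms {..<k} - (\<Union>S\<in>G. multiples k (leading_monom r S)) \<and> q - N \<in> J"
proof -
  let ?M = "monoms {..<k}"
  let ?N = "?M - (\<Union>S\<in>G. multiples k (leading_monom r S))"
  have lin: "linear_order_on ?M r" and wf: "wf (r - Id)"
    and compat: "\<And>a b c. (a, b) \<in> r \<Longrightarrow> c \<in> ?M \<Longrightarrow> (a + c, b + c) \<in> r"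
    using ord by (auto simp: monomial_order_def well_order_on_def)
  have refl: "(b, b) \<in> r" if "b \<in> ?M" for b
    using lin that by (auto simp: order_on_defs refl_on_def)
  \<comment> \<open>Here \<open>b\<close> is merely an upper bound of the exponents, whose
    coefficient may vanish. Each round clears the position \<open>b\<close>; the largest remaining
    exponent is then strictly smaller, and the order is well-founded.\<close>
  have *: "\<exists>N. Poly_Mapping.keys N \<subseteq> ?N \<and> q - N \<in> J"
    if "b \<in> ?M" "q \<in> poly_ring {..<k}" "\<forall>a\<in>Poly_Mapping.keys q. (a, b) \<in> r" for b q
    using wf that
  proof (induction b arbitrary: q rule: wf_induct_rule)
    case (less b)
    have step: "\<exists>N. Poly_Mapping.keys N \<subseteq> ?N \<and> q' - N \<in> J"
      if q': "q' \<in> poly_ring {..<k}" "\<forall>a\<in>Poly_Mapping.keys q'. (a, b) \<in> r"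
        "b \<notin> Poly_Mapping.keys q'" for q'
    proof (cases "q' = 0")
      case True
      then show ?thesis using J(1) by (intro exI[of _ 0]) auto
    next
      case False
      then obtain b' where b': "b' \<in> Poly_Mapping.keys q'" "\<forall>a\<in>Poly_Mapping.keys q'. (a, b') \<in> r"
        using linear_order_on_finite_max[OF lin, of "Poly_Mapping.keys q'"] q'(1)
        by (auto simp: poly_ring_def)
      have "(b', b) \<in> r - Id" using b'(1) q'(2,3) by auto
      moreover have "b' \<in> ?M" using b'(1) q'(1) by (auto simp: poly_ring_def)
      ultimately show ?thesis using less.IH[of b' q'] b'(2) q'(1) by blast
    qed
    let ?c = "Poly_Mapping.lookup q b"
    show ?case
    proof (cases "b \<in> ?N")
      case True
      let ?s = "Poly_Mapping.single b ?c"
      have s: "?s \<in> poly_ring {..<k}" using less.prems by (auto intro: poly_ring_single)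
      have "Poly_Mapping.keys (q - ?s) \<subseteq> insert b (Poly_Mapping.keys q)"
        by (auto simp: in_keys_iff lookup_minus lookup_single when_def split: if_splits)
      moreover have "b \<notin> Poly_Mapping.keys (q - ?s)"
        by (auto simp: in_keys_iff lookup_minus lookup_single)
      ultimately obtain N where N: "Poly_Mapping.keys N \<subseteq> ?N" "q - ?s - N \<in> J"
        using step[of "q - ?s"] s less.prems by (auto intro: poly_ring_diff)
      have "Poly_Mapping.keys (?s + N) \<subseteq> ?N"
        using keys_add[of ?s N] N(1) True by (auto split: if_splits)
      then show ?thesis using N(2) by (intro exI[of _ "?s + N"]) (simp add: algebra_simps)
    next
      case False
      then obtain S c where S: "S \<in> G" "c \<in> ?M" "b = leading_monom r S + c"
        using less.prems(1) by (auto simp: multiples_def)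
      have S0: "S \<noteq> 0" using G(2)[OF S(1)] by auto
      \<comment> \<open>Leading coefficient 1 makes \<open>?t * S\<close> cancel the term at
        \<open>b\<close> exactly; compatibility of the order with addition keeps all its exponents
        below \<open>b\<close>.\<close>
      let ?t = "Poly_Mapping.single c ?c"
      have t: "?t \<in> poly_ring {..<k}" using S(2) by (rule poly_ring_single)
      have SR: "S \<in> poly_ring {..<k}" using S(1) G(1) by blast
      have "(a, b) \<in> r" if a: "a \<in> Poly_Mapping.keys (?t * S)" for a
      proof -
        obtain d where d: "d \<in> Poly_Mapping.keys S" "a = c + d"
          using a keys_mult[of ?t S] by (auto split: if_splits)
        show ?thesis
          using compat[OF leading_monom_max(2)[OF ord SR S0 d(1)] S(2)] S(3) d(2)
          by (simp add: add.commute)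
      qed
      then have keys: "\<forall>a\<in>Poly_Mapping.keys (q - ?t * S). (a, b) \<in> r"
        using less.prems(3) by (auto simp: in_keys_iff lookup_minus)
      have "Poly_Mapping.lookup (?t * S) b = ?c"
      proof -
        have "?t * S = (\<Sum>d\<in>Poly_Mapping.keys S.
            Poly_Mapping.single (c + d) (?c * Poly_Mapping.lookup S d))"
          by (subst sum_singles[of S]) (simp add: sum_distrib_left mult_single)
        also have "Poly_Mapping.lookup \<dots> b =
            (\<Sum>d\<in>Poly_Mapping.keys S. if d = leading_monom r S then ?c * Poly_Mapping.lookup S d else 0)"
          unfolding lookup_sum
          by (rule sum.cong) (auto simp: S(3) lookup_single when_def add.commute[of c])
        also have "\<dots> = ?c"
          using leading_monom_max(1)[OF ord SR S0] G(2)[OF S(1)] by simp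
        finally show ?thesis .
      qed
      then have "b \<notin> Poly_Mapping.keys (q - ?t * S)" by (simp add: in_keys_iff lookup_minus)
      then obtain N where N: "Poly_Mapping.keys N \<subseteq> ?N" "q - ?t * S - N \<in> J"
        using step[of "q - ?t * S"] keys poly_ring_diff[OF less.prems(2) poly_ring_mult[OF t SR]]
        by blast
      have "(q - ?t * S - N) + ?t * S \<in> J" using J(2)[OF N(2) J(3)[OF S(1) t]] .
      then show ?thesis using N(1) by (auto simp: algebra_simps)
    qed
  qed
  show ?thesis
  proof (cases "q = 0")
    case True
    then show ?thesis using J(1) by (intro exI[of _ 0]) auto
  next
    case False
    then show ?thesis
      using *[of "leading_monom r q" q] leading_monom_max[OF ord q False] q
      by (auto simp: poly_ring_def)
  qed
qed

text \<open>The source of all uniqueness statements: the leading exponent of a nonzero relation is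
  never normal.\<close>

lemma normal_relation_eq_0:
  assumes "monomial_order k r" "reduced_groebner_basis k r I G" "N \<in> I"
    and "Poly_Mapping.keys N \<subseteq> monoms {..<k} - (\<Union>S\<in>G. multiples k (leading_monom r S))"
  shows "N = 0"
proof (rule ccontr)
  assume "N \<noteq> 0"
  have "N \<in> poly_ring {..<k}" using assms(4) by (auto simp: poly_ring_def)
  then have "leading_monom r N \<in> Poly_Mapping.keys N"
    using leading_monom_max(1)[OF assms(1)] \<open>N \<noteq> 0\<close> by blast
  then show False
    using leading_monom_in_multiples[OF assms(2,3) \<open>N \<noteq> 0\<close>] assms(4) by blast
qed

text \<open>A Groebner basis generates its ideal.\<close>

lemma groebner_basis_induct:
  assumes ord: "monomial_order k r" and gb: "reduced_groebner_basis k r I G"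
    and I: "I \<subseteq> poly_ring {..<k}" "\<And>p q. p \<in> I \<Longrightarrow> q \<in> I \<Longrightarrow> p - q \<in> I"
    and J: "J \<subseteq> I" "0 \<in> J" "\<And>p q. p \<in> J \<Longrightarrow> q \<in> J \<Longrightarrow> p + q \<in> J"
      "\<And>S p. S \<in> G \<Longrightarrow> p \<in> poly_ring {..<k} \<Longrightarrow> p * S \<in> J"
    and q: "q \<in> I"
  shows "q \<in> J"
proof -
  have "G \<subseteq> poly_ring {..<k}" "\<And>S. S \<in> G \<Longrightarrow> Poly_Mapping.lookup S (leading_monom r S) = 1"
    using gb I(1) by (auto simp: reduced_groebner_basis_def)
  then obtain N where N: "Poly_Mapping.keys N \<subseteq>
      monoms {..<k} - (\<Union>S\<in>G. multiples k (leading_monom r S))" "q - N \<in> J"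
    using normal_form_exists[OF ord _ _ J(2-4), where q = q] q I(1) by blast
  \<comment> \<open>The remainder \<open>N\<close> is itself a relation, and being normal it
    vanishes.\<close>
  have "q - (q - N) \<in> I" using N(2) J(1) q by (blast intro: I(2))
  then have "N = 0" using normal_relation_eq_0[OF ord gb _ N(1)] by simp
  then show ?thesis using N(2) by simp
qed

section \<open>Invariants by reparametrization\<close>

lemma invariants_in_poly_ring: "P \<in> invariants n \<kappa> m \<Longrightarrow> P \<in> poly_ring (jet_vars n \<kappa>)"
  by (simp add: invariants_def)

lemma invariants_const: "const c \<in> invariants n \<kappa> 0"
  by (simp add: invariants_def)

lemma invariants_0: "0 \<in> invariants n \<kappa> m"
  by (simp add: invariants_def)

lemma invariants_eventually:
  assumes "P \<in> invariants n \<kappa> m" "\<forall>i\<in>{1..n}. f i analytic_on {0}"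
    "\<phi> analytic_on {0}" "\<phi> 0 = 0" "deriv \<phi> 0 \<noteq> 0"
  shows "\<forall>\<^sub>F \<zeta> in nhds 0.
    eval_at (jet (\<lambda>i. f i \<circ> \<phi>) \<zeta>) P = deriv \<phi> \<zeta> ^ m * eval_at (jet f (\<phi> \<zeta>)) P"
  using assms by (auto simp: invariants_def)

lemma invariants_add:
  assumes P: "P \<in> invariants n \<kappa> m" and Q: "Q \<in> invariants n \<kappa> m"
  shows "P + Q \<in> invariants n \<kappa> m"
  unfolding invariants_def
proof (intro CollectI conjI allI impI)
  show "P + Q \<in> poly_ring (jet_vars n \<kappa>)"
    using assms by (intro poly_ring_add invariants_in_poly_ring)
  fix f :: "nat \<Rightarrow> complex \<Rightarrow> complex" and \<phi> :: "complex \<Rightarrow> complex"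
  assume H: "\<forall>i\<in>{1..n}. f i analytic_on {0}" "\<phi> analytic_on {0}" "\<phi> 0 = 0" "deriv \<phi> 0 \<noteq> 0"
  from invariants_eventually[OF P H] invariants_eventually[OF Q H]
  show "\<forall>\<^sub>F \<zeta> in nhds 0. eval_at (jet (\<lambda>i. f i \<circ> \<phi>) \<zeta>) (P + Q) =
      deriv \<phi> \<zeta> ^ m * eval_at (jet f (\<phi> \<zeta>)) (P + Q)"
    by eventually_elim (simp add: distrib_left)
qed

lemma invariants_mult:
  assumes P: "P \<in> invariants n \<kappa> p" and Q: "Q \<in> invariants n \<kappa> q"
  shows "P * Q \<in> invariants n \<kappa> (p + q)"
  unfolding invariants_def
proof (intro CollectI conjI allI impI)
  show "P * Q \<in> poly_ring (jet_vars n \<kappa>)"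
    using assms by (intro poly_ring_mult invariants_in_poly_ring)
  fix f :: "nat \<Rightarrow> complex \<Rightarrow> complex" and \<phi> :: "complex \<Rightarrow> complex"
  assume H: "\<forall>i\<in>{1..n}. f i analytic_on {0}" "\<phi> analytic_on {0}" "\<phi> 0 = 0" "deriv \<phi> 0 \<noteq> 0"
  from invariants_eventually[OF P H] invariants_eventually[OF Q H]
  show "\<forall>\<^sub>F \<zeta> in nhds 0. eval_at (jet (\<lambda>i. f i \<circ> \<phi>) \<zeta>) (P * Q) =
      deriv \<phi> \<zeta> ^ (p + q) * eval_at (jet f (\<phi> \<zeta>)) (P * Q)"
    by eventually_elim (simp add: power_add)
qed

lemma invariants_const_mult: "P \<in> invariants n \<kappa> m \<Longrightarrow> const c * P \<in> invariants n \<kappa> m"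
  using invariants_mult[OF invariants_const[of c n \<kappa>], of P m] by simp

lemma invariants_uminus: "P \<in> invariants n \<kappa> m \<Longrightarrow> - P \<in> invariants n \<kappa> m"
proof -
  have "- P = const (-1) * P" by (rule eval_at_inject) simp
  then show "P \<in> invariants n \<kappa> m \<Longrightarrow> - P \<in> invariants n \<kappa> m"
    using invariants_const_mult[of P n \<kappa> m "-1"] by simp
qed

lemma invariants_diff:
  "P \<in> invariants n \<kappa> m \<Longrightarrow> Q \<in> invariants n \<kappa> m \<Longrightarrow> P - Q \<in> invariants n \<kappa> m"
  using invariants_add[of P n \<kappa> m "- Q"] invariants_uminus[of Q n \<kappa> m] by simp

lemma invariants_sum:
  "(\<And>i. i \<in> I \<Longrightarrow> P i \<in> invariants n \<kappa> m) \<Longrightarrow> sum P I \<in> invariants n \<kappa> m"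
  by (induction I rule: infinite_finite_induct) (auto intro: invariants_0 invariants_add)

lemma invariants_power: "P \<in> invariants n \<kappa> m \<Longrightarrow> P ^ k \<in> invariants n \<kappa> (m * k)"
proof (induction k)
  case 0
  then show ?case using invariants_const[of 1] by simp
next
  case (Suc k)
  then show ?case using invariants_mult[of P n \<kappa> m "P ^ k" "m * k"] by simp
qed

lemma invariants_prod:
  "finite I \<Longrightarrow> (\<And>i. i \<in> I \<Longrightarrow> P i \<in> invariants n \<kappa> (m i)) \<Longrightarrow> prod P I \<in> invariants n \<kappa> (sum m I)"
proof (induction I rule: finite_induct)
  case empty
  then show ?case using invariants_const[of 1] by simp
qed (auto intro: invariants_mult)

section \<open>The transformation law at a single point\<close>

lemma eventually_analytic_at:
  assumes "f analytic_on {z :: complex}"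
  shows "\<forall>\<^sub>F w in nhds z. f analytic_on {w}"
proof -
  obtain S where S: "open S" "z \<in> S" "f holomorphic_on S"
    using assms by (auto simp: analytic_at)
  then show ?thesis unfolding eventually_nhds by (metis analytic_at)
qed

lemma eventually_analytic_at_compose:
  assumes "f analytic_on {0}" "\<phi> analytic_on {0}" "\<phi> 0 = (0 :: complex)"
  shows "\<forall>\<^sub>F \<zeta> in nhds 0. f analytic_on {\<phi> \<zeta>}"
proof -
  have "filterlim \<phi> (nhds 0) (nhds 0)"
    using analytic_at_imp_isCont[OF assms(2)]
    by (metis assms(3) isCont_def tendsto_at_iff_tendsto_nhds)
  then show ?thesis by (rule eventually_compose_filterlim[OF eventually_analytic_at[OF assms(1)]])
qed

lemma f1'_invariant:
  assumes "n \<ge> 1" "\<kappa> \<ge> 1"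
  shows "f1' \<in> invariants n \<kappa> 1"
  unfolding invariants_def
proof (intro CollectI conjI allI impI)
  show "f1' \<in> poly_ring (jet_vars n \<kappa>)"
    using assms by (auto simp: f1'_def jet_vars_def)
  fix f :: "nat \<Rightarrow> complex \<Rightarrow> complex" and \<phi> :: "complex \<Rightarrow> complex"
  assume f: "\<forall>i\<in>{1..n}. f i analytic_on {0}" and \<phi>: "\<phi> analytic_on {0}" "\<phi> 0 = 0"
  have "\<forall>\<^sub>F \<zeta> in nhds 0. f 1 analytic_on {\<phi> \<zeta>}"
    using f \<phi> assms by (intro eventually_analytic_at_compose) auto
  with eventually_analytic_at[OF \<phi>(1)]
  show "\<forall>\<^sub>F \<zeta> in nhds 0. eval_at (jet (\<lambda>i. f i \<circ> \<phi>) \<zeta>) f1' =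
      deriv \<phi> \<zeta> ^ 1 * eval_at (jet f (\<phi> \<zeta>)) f1'"
  proof eventually_elim
    case (elim \<zeta>)
    then have "deriv (f 1 \<circ> \<phi>) \<zeta> = deriv (f 1) (\<phi> \<zeta>) * deriv \<phi> \<zeta>"
      by (intro deriv_chain analytic_on_imp_differentiable_at) auto
    then show ?case by (simp add: jet_def)
  qed
qed

lemma invariantsD:
  assumes "P \<in> invariants n \<kappa> m" "\<And>i. i \<in> {1..n} \<Longrightarrow> f i analytic_on {0}"
    "\<phi> analytic_on {0}" "\<phi> 0 = 0" "deriv \<phi> 0 \<noteq> 0"
  shows "eval_at (jet (\<lambda>i. f i \<circ> \<phi>) 0) P = deriv \<phi> 0 ^ m * eval_at (jet f 0) P"
proof -
  have "\<forall>\<^sub>F \<zeta> in nhds 0.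
      eval_at (jet (\<lambda>i. f i \<circ> \<phi>) \<zeta>) P = deriv \<phi> \<zeta> ^ m * eval_at (jet f (\<phi> \<zeta>)) P"
    using assms by (intro invariants_eventually) auto
  then show ?thesis using eventually_nhds_x_imp_x assms(4) by fastforce
qed

lemma higher_deriv_translate:
  "(deriv ^^ s) (\<lambda>w. f (a + w)) 0 = (deriv ^^ s) f (a :: complex)"
  using higher_deriv_shift_0[of s f a] by (simp add: o_def)

text \<open>Since the law is assumed for all germs, its validity at 0 implies its validity at nearby
  points: translation carries such a point to 0. The derivative of the reparametrization stays
  nonzero nearby by continuity.\<close>

lemma invariantsI:
  assumes P: "P \<in> poly_ring (jet_vars n \<kappa>)"
    and inv: "\<And>f \<phi>. (\<And>i. i \<in> {1..n} \<Longrightarrow> f i analytic_on {0}) \<Longrightarrow> \<phi> analytic_on {0} \<Longrightarrow>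
      \<phi> 0 = 0 \<Longrightarrow> deriv \<phi> 0 \<noteq> 0 \<Longrightarrow>
      eval_at (jet (\<lambda>i. f i \<circ> \<phi>) 0) P = deriv \<phi> 0 ^ m * eval_at (jet f 0) P"
  shows "P \<in> invariants n \<kappa> m"
  unfolding invariants_def
proof (intro CollectI conjI allI impI)
  show "P \<in> poly_ring (jet_vars n \<kappa>)" by (rule P)
  fix f :: "nat \<Rightarrow> complex \<Rightarrow> complex" and \<phi> :: "complex \<Rightarrow> complex"
  assume f: "\<forall>i\<in>{1..n}. f i analytic_on {0}"
    and \<phi>: "\<phi> analytic_on {0}" "\<phi> 0 = 0" "deriv \<phi> 0 \<noteq> 0"
  have "isCont (deriv \<phi>) 0"
    using analytic_deriv[OF \<phi>(1)] by (rule analytic_at_imp_isCont)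
  then have "filterlim (deriv \<phi>) (nhds (deriv \<phi> 0)) (nhds 0)"
    by (metis isCont_def tendsto_at_iff_tendsto_nhds)
  then have 1: "\<forall>\<^sub>F \<zeta> in nhds 0. deriv \<phi> \<zeta> \<noteq> 0"
    using \<phi>(3) by (rule tendsto_imp_eventually_ne)
  have 2: "\<forall>\<^sub>F \<zeta> in nhds 0. \<forall>i\<in>{1..n}. f i analytic_on {\<phi> \<zeta>}"
    using f \<phi> by (intro eventually_ball_finite) (auto intro: eventually_analytic_at_compose)
  from 1 2 eventually_analytic_at[OF \<phi>(1)]
  show "\<forall>\<^sub>F \<zeta> in nhds 0.
      eval_at (jet (\<lambda>i. f i \<circ> \<phi>) \<zeta>) P = deriv \<phi> \<zeta> ^ m * eval_at (jet f (\<phi> \<zeta>)) P"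
  proof eventually_elim
    case (elim \<zeta>)
    \<comment> \<open>Subtracting \<open>\<phi> \<zeta>\<close> makes the reparametrization fix 0,
      and \<open>?f\<close> adds it back, so the composite is \<open>f i \<circ> \<phi>\<close>
      translated by \<open>\<zeta>\<close>.\<close>
    let ?f = "\<lambda>i w. f i (\<phi> \<zeta> + w)" and ?\<phi> = "\<lambda>w. \<phi> (\<zeta> + w) - \<phi> \<zeta>"
    have translate: "(\<lambda>w. h (a + w)) analytic_on {0}" if "h analytic_on {a}"
      for h :: "complex \<Rightarrow> complex" and a
    proof -
      have "(\<lambda>w. a + w) analytic_on {0}" by (intro analytic_intros)
      then show ?thesis using analytic_on_compose[of "\<lambda>w. a + w" "{0}" h] that by (simp add: o_def)
    qed
    have d: "deriv ?\<phi> 0 = deriv \<phi> \<zeta>"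
    proof -
      have "\<phi> field_differentiable at \<zeta>"
        using elim by (intro analytic_on_imp_differentiable_at) auto
      then have "((\<lambda>w. \<phi> (\<zeta> + w)) has_field_derivative deriv \<phi> \<zeta>) (at 0)"
        using DERIV_shift[of \<phi> "deriv \<phi> \<zeta>" 0 \<zeta>]
        by (simp add: DERIV_deriv_iff_field_differentiable add.commute)
      then have "(?\<phi> has_field_derivative deriv \<phi> \<zeta>) (at 0)"
        by (auto intro!: derivative_eq_intros)
      then show ?thesis by (rule DERIV_imp_deriv)
    qed
    have "eval_at (jet (\<lambda>i. ?f i \<circ> ?\<phi>) 0) P = deriv ?\<phi> 0 ^ m * eval_at (jet ?f 0) P"
      using elim d by (intro inv translate analytic_on_diff) (auto intro!: analytic_intros)
    moreover have "jet (\<lambda>i. ?f i \<circ> ?\<phi>) 0 = jet (\<lambda>i. f i \<circ> \<phi>) \<zeta>"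
      unfolding jet_def o_def
      using higher_deriv_translate[of _ "\<lambda>w. f _ (\<phi> w)" \<zeta>] by (auto simp: fun_eq_iff)
    moreover have "jet ?f 0 = jet f (\<phi> \<zeta>)"
      unfolding jet_def by (simp add: higher_deriv_translate)
    ultimately show ?case using d by simp
  qed
qed

section \<open>Limits in a parameter and division by \<open>f1'\<close>\<close>

lemma isCont_eval_at:
  assumes "\<And>x. isCont (\<lambda>t. z t x) t"
  shows "isCont (\<lambda>t. eval_at (z t) P) t"
  unfolding eval_at_eq monom_eval_def by (intro continuous_intros assms)

text \<open>Recovers an identity at an excluded parameter: perturbation 0 in
  \<open>invariants_divide_f1'\<close>, the degenerate dilation in
  \<open>invariants_0_const\<close>.\<close>

lemma isCont_eq_punctured:
  fixes f g :: "complex \<Rightarrow> complex"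
  assumes "isCont f a" "isCont g a" "\<And>t. t \<noteq> a \<Longrightarrow> f t = g t"
  shows "f a = g a"
proof -
  have "f \<midarrow>a\<rightarrow> f a" "g \<midarrow>a\<rightarrow> g a" using assms by (auto simp: isCont_def)
  moreover have "f \<midarrow>a\<rightarrow> g a \<longleftrightarrow> g \<midarrow>a\<rightarrow> g a"
    by (rule filterlim_cong) (auto simp: eventually_at_filter assms(3))
  ultimately show ?thesis using LIM_unique by blast
qed

lemma higher_deriv_add_cmult_at:
  assumes "g analytic_on {a}" "h analytic_on {a :: complex}"
  shows "(deriv ^^ s) (\<lambda>w. g w + t * h w) a = (deriv ^^ s) g a + t * (deriv ^^ s) h a"
proof -
  have "(\<lambda>w. t * h w) analytic_on {a}" using assms(2) by (intro analytic_intros)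
  then show ?thesis
    using assms by (simp add: higher_deriv_add_at higher_deriv_cmult')
qed

text \<open>Where \<open>f\<^sub>1'\<close> vanishes, the factor cannot be cancelled pointwise; there \<open>f\<^sub>1\<close> is perturbed
  to \<open>f\<^sub>1 + t \<zeta>\<close>, whose jets are affine in \<open>t\<close>, and \<open>t\<close> tends to 0.\<close>

lemma invariants_divide_f1':
  assumes n: "n \<ge> 1" "\<kappa> \<ge> 1" and P: "P \<in> poly_ring (jet_vars n \<kappa>)"
    and inv: "f1' * P \<in> invariants n \<kappa> (Suc m)"
  shows "P \<in> invariants n \<kappa> m"
proof (rule invariantsI[OF P])
  fix f :: "nat \<Rightarrow> complex \<Rightarrow> complex" and \<phi> :: "complex \<Rightarrow> complex"
  assume f: "\<And>i. i \<in> {1..n} \<Longrightarrow> f i analytic_on {0}"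
    and \<phi>: "\<phi> analytic_on {0}" "\<phi> 0 = 0" "deriv \<phi> 0 \<noteq> 0"
  define F where "F = (\<lambda>t i w. f i w + (if i = 1 then t * w else (0::complex)))"
  have F: "F t i analytic_on {0}" if "i \<in> {1..n}" for t i
    using f[OF that] unfolding F_def by (cases "i = 1") (auto intro!: analytic_intros)
  have eq: "eval_at (jet (\<lambda>i. F t i \<circ> \<phi>) 0) P = deriv \<phi> 0 ^ m * eval_at (jet (F t) 0) P"
    if t: "deriv (F t 1) 0 \<noteq> 0" for t
  proof -
    have "eval_at (jet (\<lambda>i. F t i \<circ> \<phi>) 0) (f1' * P) =
        deriv \<phi> 0 ^ Suc m * eval_at (jet (F t) 0) (f1' * P)"
      by (rule invariantsD[OF inv F \<phi>])
    moreover have "eval_at (jet (\<lambda>i. F t i \<circ> \<phi>) 0) f1' = deriv \<phi> 0 ^ 1 * eval_at (jet (F t) 0) f1'"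
      by (rule invariantsD[OF f1'_invariant[OF n] F \<phi>])
    ultimately show ?thesis using t \<phi>(3) by (simp add: jet_def)
  qed
  have jF: "jet (F t) 0 (i, s) = jet f 0 (i, s) +
      (if i = 1 then t * (deriv ^^ s) (\<lambda>w. w) 0 else 0)" if "i \<in> {1..n}" for t i s
    using higher_deriv_add_cmult_at[OF f[OF that] analytic_on_ident, of s t]
    by (auto simp: jet_def F_def simp del: higher_deriv_ident)
  have jF\<phi>: "jet (\<lambda>i. F t i \<circ> \<phi>) 0 (i, s) = jet (\<lambda>i. f i \<circ> \<phi>) 0 (i, s) +
      (if i = 1 then t * (deriv ^^ s) \<phi> 0 else 0)" if "i \<in> {1..n}" for t i s
  proof -
    have "(f i \<circ> \<phi>) analytic_on {0}"
      using f[OF that] \<phi> by (intro analytic_on_compose) auto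
    then have "(\<lambda>w. f i (\<phi> w)) analytic_on {0}" by (simp add: o_def)
    then show ?thesis
      using higher_deriv_add_cmult_at[OF _ \<phi>(1), of "\<lambda>w. f i (\<phi> w)" s t]
      by (auto simp: jet_def F_def o_def)
  qed
  show "eval_at (jet (\<lambda>i. f i \<circ> \<phi>) 0) P = deriv \<phi> 0 ^ m * eval_at (jet f 0) P"
  proof (cases "deriv (f 1) 0 = 0")
    case False
    moreover have "F 0 = f" by (simp add: F_def fun_eq_iff)
    ultimately show ?thesis using eq[of 0] by simp
  next
    case True
    \<comment> \<open>Continuity is required in every coordinate, including components outside
      \<open>{1..n}\<close> where nothing is known about \<open>f\<close>. The affine formulas are
      therefore taken as definitions; they agree with the perturbed jets on the variables of
      \<open>P\<close>.\<close>
    define a where "a = (\<lambda>t (i, s). jet (\<lambda>i. f i \<circ> \<phi>) 0 (i, s) +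
      t * (if i = 1 then (deriv ^^ s) \<phi> 0 else 0))"
    define b where "b = (\<lambda>t (i, s). jet f 0 (i, s) +
      t * (if i = 1 then (deriv ^^ s) (\<lambda>w. w) 0 else (0::complex)))"
    have "eval_at (a 0) P = deriv \<phi> 0 ^ m * eval_at (b 0) P"
    proof (rule isCont_eq_punctured[where f = "\<lambda>t. eval_at (a t) P"
          and g = "\<lambda>t. deriv \<phi> 0 ^ m * eval_at (b t) P"])
      show "isCont (\<lambda>t. eval_at (a t) P) 0"
        by (rule isCont_eval_at) (auto simp: a_def split: prod.splits)
      show "isCont (\<lambda>t. deriv \<phi> 0 ^ m * eval_at (b t) P) 0"
        by (intro continuous_intros isCont_eval_at) (auto simp: b_def split: prod.splits)
      fix t :: complex assume "t \<noteq> 0"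
      \<comment> \<open>Since \<open>f 1\<close> has derivative 0 at 0, the perturbed component has
        derivative \<open>t\<close> there.\<close>
      then have "deriv (F t 1) 0 \<noteq> 0"
        using jF[of 1 t 1] n True by (simp add: jet_def)
      from eq[OF this]
      show "eval_at (a t) P = deriv \<phi> 0 ^ m * eval_at (b t) P"
        using eval_at_cong[OF P, of "a t" "jet (\<lambda>i. F t i \<circ> \<phi>) 0"]
          eval_at_cong[OF P, of "b t" "jet (F t) 0"]
        by (auto simp: a_def b_def jF jF\<phi> jet_vars_def)
    qed
    moreover have "a 0 = jet (\<lambda>i. f i \<circ> \<phi>) 0" "b 0 = jet f 0"
      by (auto simp: a_def b_def fun_eq_iff)
    ultimately show ?thesis by simp
  qed
qed

section \<open>Jets of polynomial germs\<close>

text \<open>Realizes an arbitrary point of jet space by an entire germ, turning laws for germs into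
  identities in \<open>z\<close>. The sum starts at 1, so that the germ and the local inverse of its
  first component fix 0.\<close>

definition taylor_germ :: "nat \<Rightarrow> (nat \<times> nat \<Rightarrow> complex) \<Rightarrow> nat \<Rightarrow> complex \<Rightarrow> complex" where
  "taylor_germ \<kappa> z i \<zeta> = (\<Sum>s\<in>{1..\<kappa>}. z (i, s) / fact s * \<zeta> ^ s)"

lemma taylor_germ_holomorphic: "taylor_germ \<kappa> z i holomorphic_on S"
  unfolding taylor_germ_def by (intro holomorphic_intros)

lemma taylor_germ_at_0 [simp]: "taylor_germ \<kappa> z i 0 = 0"
  by (simp add: taylor_germ_def)

lemma jet_taylor_germ:
  assumes "s \<in> {1..\<kappa>}"
  shows "jet (taylor_germ \<kappa> z) 0 (i, s) = z (i, s)"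
proof -
  define F where "F S = (\<Sum>s\<in>S. fps_const (z (i, s) / fact s) * fps_X ^ s)" for S
  have "(\<lambda>\<zeta>. \<Sum>s\<in>S. z (i, s) / fact s * \<zeta> ^ s) has_fps_expansion F S" for S
    unfolding F_def
    by (intro has_fps_expansion_sum has_fps_expansion_cmult_left has_fps_expansion_fps_X_power)
  then have "taylor_germ \<kappa> z i has_fps_expansion F {1..\<kappa>}"
    unfolding taylor_germ_def by simp
  then have "fps_nth (F {1..\<kappa>}) s = (deriv ^^ s) (taylor_germ \<kappa> z i) 0 / fact s"
    by (rule fps_nth_fps_expansion)
  moreover have "fps_nth (F {1..\<kappa>}) s = (\<Sum>t\<in>{1..\<kappa>}. if t = s then z (i, t) / fact t else 0)"
    unfolding F_def fps_sum_nth by (intro sum.cong) (auto simp: fps_X_power_nth)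
  ultimately show ?thesis using assms by (simp add: jet_def)
qed

lemma eval_at_jet_taylor_germ:
  "P \<in> poly_ring (A \<times> {1..\<kappa>}) \<Longrightarrow> eval_at (jet (taylor_germ \<kappa> z) 0) P = eval_at z P"
  by (rule eval_at_cong) (auto simp: jet_taylor_germ simp del: One_nat_def)

lemma taylor_germ_analytic: "taylor_germ \<kappa> z i analytic_on S"
  by (meson analytic_on_holomorphic open_UNIV subset_UNIV taylor_germ_holomorphic)

text \<open>Comes from the reparametrization by the dilation with factor \<open>c\<close>, which
  multiplies a derivative of order \<open>s\<close> by \<open>c ^ s\<close>.\<close>

lemma invariants_weighted_homogeneous:
  assumes P: "P \<in> invariants n \<kappa> m" and "c \<noteq> 0"
  shows "eval_at (\<lambda>(i, s). c ^ s * z (i, s)) P = c ^ m * eval_at z P"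
proof -
  let ?f = "taylor_germ \<kappa> z"
  note ring = invariants_in_poly_ring[OF P, unfolded jet_vars_def]
  have "eval_at (jet (\<lambda>i. ?f i \<circ> (\<lambda>w. c * w)) 0) P = deriv (\<lambda>w. c * w) 0 ^ m * eval_at (jet ?f 0) P"
    using assms by (intro invariantsD[OF P] taylor_germ_analytic) (auto intro!: analytic_intros)
  moreover have "jet (\<lambda>i. ?f i \<circ> (\<lambda>w. c * w)) 0 = (\<lambda>(i, s). c ^ s * jet ?f 0 (i, s))"
    using higher_deriv_compose_linear[OF taylor_germ_holomorphic[of \<kappa> z _ UNIV] open_UNIV open_UNIV]
    by (auto simp: jet_def o_def fun_eq_iff)
  moreover have "eval_at (\<lambda>(i, s). c ^ s * jet ?f 0 (i, s)) P = eval_at (\<lambda>(i, s). c ^ s * z (i, s)) P"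
    by (rule eval_at_cong[OF ring]) (auto simp: jet_taylor_germ simp del: One_nat_def)
  ultimately show ?thesis by (simp add: eval_at_jet_taylor_germ[OF ring])
qed

text \<open>In weight 0 the value is unchanged by dilations, and as \<open>c\<close> tends to 0
  every jet shrinks to the origin, all orders being at least 1. This starts the induction on the
  weight and excludes weight 0 from the list.\<close>

lemma invariants_0_const:
  assumes P: "P \<in> invariants n \<kappa> 0"
  shows "\<exists>c. P = const c"
proof -
  have "P = const (eval_at (\<lambda>_. 0) P)"
  proof (rule eval_at_inject)
    fix z :: "nat \<times> nat \<Rightarrow> complex"
    let ?z = "\<lambda>c (i, s). c ^ s * z (i, s)"
    have "eval_at (?z 0) P = eval_at z P"
    proof (rule isCont_eq_punctured[where f = "\<lambda>c. eval_at (?z c) P"])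
      show "isCont (\<lambda>c. eval_at (?z c) P) 0"
        by (rule isCont_eval_at) (auto split: prod.splits)
    qed (auto simp: invariants_weighted_homogeneous[OF P])
    moreover have "eval_at (?z 0) P = eval_at (\<lambda>_. 0) P"
      by (rule eval_at_cong[OF invariants_in_poly_ring[OF P]]) (auto simp: jet_vars_def)
    ultimately show "eval_at z P = eval_at z (const (eval_at (\<lambda>_. 0) P))" by simp
  qed
  then show ?thesis by blast
qed

section \<open>The total derivative\<close>

lemma monom_eval_has_field_derivative:
  fixes z :: "complex \<Rightarrow> 'x \<Rightarrow> complex"
  assumes "\<And>x. x \<in> Poly_Mapping.keys b \<Longrightarrow> ((\<lambda>t. z t x) has_field_derivative z' x) (at \<zeta>)"
  shows "((\<lambda>t. monom_eval (z t) b) has_field_derivative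
    (\<Sum>x\<in>Poly_Mapping.keys b. z' x *
      (of_nat (Poly_Mapping.lookup b x) * monom_eval (z \<zeta>) (b - Poly_Mapping.single x 1)))) (at \<zeta>)"
proof -
  have eq: "of_nat (Poly_Mapping.lookup b x) * (z' x * z \<zeta> x ^ (Poly_Mapping.lookup b x - 1)) *
        (\<Prod>y\<in>Poly_Mapping.keys b - {x}. z \<zeta> y ^ Poly_Mapping.lookup b y) =
      z' x * (of_nat (Poly_Mapping.lookup b x) * monom_eval (z \<zeta>) (b - Poly_Mapping.single x 1))"
    if x: "x \<in> Poly_Mapping.keys b" for x
  proof -
    have "monom_eval (z \<zeta>) (b - Poly_Mapping.single x 1) =
        (\<Prod>y\<in>Poly_Mapping.keys b. z \<zeta> y ^ Poly_Mapping.lookup (b - Poly_Mapping.single x 1) y)"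
      by (rule monom_eval_superset) (auto simp: in_keys_iff lookup_minus)
    also have "\<dots> = z \<zeta> x ^ (Poly_Mapping.lookup b x - 1) *
        (\<Prod>y\<in>Poly_Mapping.keys b - {x}. z \<zeta> y ^ Poly_Mapping.lookup (b - Poly_Mapping.single x 1) y)"
      using x by (subst prod.remove[of _ x]) (auto simp: lookup_minus)
    also have "(\<Prod>y\<in>Poly_Mapping.keys b - {x}. z \<zeta> y ^ Poly_Mapping.lookup (b - Poly_Mapping.single x 1) y) =
        (\<Prod>y\<in>Poly_Mapping.keys b - {x}. z \<zeta> y ^ Poly_Mapping.lookup b y)"
      by (rule prod.cong) (auto simp: lookup_minus lookup_single when_def)
    finally show ?thesis by (simp add: mult_ac)
  qed
  have "((\<lambda>t. \<Prod>x\<in>Poly_Mapping.keys b. z t x ^ Poly_Mapping.lookup b x) has_field_derivative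
    (\<Sum>x\<in>Poly_Mapping.keys b.
       of_nat (Poly_Mapping.lookup b x) * (z' x * z \<zeta> x ^ (Poly_Mapping.lookup b x - 1)) *
       (\<Prod>y\<in>Poly_Mapping.keys b - {x}. z \<zeta> y ^ Poly_Mapping.lookup b y))) (at \<zeta>)"
    using assms by (intro has_field_derivative_prod) (auto intro!: derivative_eq_intros)
  then show ?thesis unfolding monom_eval_def[of _ b] by (simp only: sum.cong[OF refl eq])
qed

lemma eval_at_partial_deriv:
  "eval_at z (partial_deriv x p) = (\<Sum>b\<in>Poly_Mapping.keys p. Poly_Mapping.lookup p b *
     (of_nat (Poly_Mapping.lookup b x) * monom_eval z (b - Poly_Mapping.single x 1)))"
  by (simp add: partial_deriv_def mult_ac)

text \<open>The chain rule along a curve whose coordinates satisfy the contact equations, as the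
  jets of a function do.\<close>

lemma eval_at_total_deriv:
  assumes "\<And>i s. ((\<lambda>t. z t (i, s)) has_field_derivative z \<zeta> (i, Suc s)) (at \<zeta>)"
  shows "((\<lambda>t. eval_at (z t) P) has_field_derivative eval_at (z \<zeta>) (total_deriv P)) (at \<zeta>)"
proof -
  let ?W = "\<Union>b\<in>Poly_Mapping.keys P. Poly_Mapping.keys b"
  define z' where "z' = (\<lambda>(i, s). z \<zeta> (i, Suc s))"
  let ?d = "\<lambda>b x. of_nat (Poly_Mapping.lookup b x) * monom_eval (z \<zeta>) (b - Poly_Mapping.single x 1)"
  have "((\<lambda>t. eval_at (z t) P) has_field_derivative
      (\<Sum>b\<in>Poly_Mapping.keys P. Poly_Mapping.lookup P b *
        (\<Sum>x\<in>Poly_Mapping.keys b. z' x * ?d b x))) (at \<zeta>)"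
    unfolding eval_at_eq
    using assms
    by (intro DERIV_sum DERIV_cmult monom_eval_has_field_derivative) (auto simp: z'_def)
  \<comment> \<open>Each inner sum is extended by zero terms to the common variable set of
    \<open>total_deriv\<close>, so that the two summations can be exchanged.\<close>
  moreover have "(\<Sum>x\<in>Poly_Mapping.keys b. z' x * ?d b x) = (\<Sum>x\<in>?W. z' x * ?d b x)"
    if "b \<in> Poly_Mapping.keys P" for b
    using that by (intro sum.mono_neutral_left) (auto simp: in_keys_iff)
  moreover have "(\<Sum>b\<in>Poly_Mapping.keys P. Poly_Mapping.lookup P b * (\<Sum>x\<in>?W. z' x * ?d b x)) =
      (\<Sum>x\<in>?W. z' x * eval_at (z \<zeta>) (partial_deriv x P))"
    unfolding eval_at_partial_deriv sum_distrib_left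
    by (subst sum.swap) (simp add: mult_ac)
  moreover have "\<dots> = eval_at (z \<zeta>) (total_deriv P)"
    unfolding total_deriv_def z'_def eval_at_sum by (intro sum.cong) auto
  ultimately show ?thesis by simp
qed

lemma partial_deriv_in_poly_ring:
  assumes "p \<in> poly_ring V"
  shows "partial_deriv x p \<in> poly_ring V"
  unfolding partial_deriv_def
proof (intro poly_ring_sum poly_ring_single)
  fix b assume "b \<in> Poly_Mapping.keys p"
  then have "Poly_Mapping.keys b \<subseteq> V" using assms by (auto simp: poly_ring_def monoms_def)
  moreover have "Poly_Mapping.keys (b - Poly_Mapping.single x 1) \<subseteq> Poly_Mapping.keys b"
    by (auto simp: in_keys_iff lookup_minus)
  ultimately show "b - Poly_Mapping.single x 1 \<in> monoms V" by (auto simp: monoms_def)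
qed

lemma poly_ring_jets_mono:
  assumes "p \<in> poly_ring (A \<times> {1..a})" "a \<le> (b :: nat)"
  shows "p \<in> poly_ring (A \<times> {1..b})"
proof -
  have "A \<times> {1..a} \<subseteq> A \<times> {1..b}" using assms(2) by auto
  then show ?thesis using assms(1) unfolding poly_ring_def monoms_def by blast
qed

lemma total_deriv_in_poly_ring:
  assumes "P \<in> poly_ring (A \<times> {1..\<kappa>})"
  shows "total_deriv P \<in> poly_ring (A \<times> {1..Suc \<kappa>})"
  unfolding total_deriv_def
proof (intro poly_ring_sum, clarify, intro poly_ring_mult)
  fix b i s assume "b \<in> Poly_Mapping.keys P" "(i, s) \<in> Poly_Mapping.keys b"
  then have "(i, s) \<in> A \<times> {1..\<kappa>}" using assms unfolding poly_ring_def monoms_def by blast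
  then show "var (i, Suc s) \<in> poly_ring (A \<times> {1..Suc \<kappa>})" by (intro poly_ring_var) auto
  show "partial_deriv (i, s) P \<in> poly_ring (A \<times> {1..Suc \<kappa>})"
    by (rule poly_ring_jets_mono[OF partial_deriv_in_poly_ring[OF assms]]) simp
qed

text \<open>Only the jet order matters: for \<open>t < \<kappa>\<close> the value at a jet is
  already determined by the Taylor germ of order \<open>\<kappa>\<close>.\<close>

lemma Lambda_in_poly_ring: "Lambda i t \<in> poly_ring (UNIV \<times> {1..Suc t})"
proof (induction t)
  case 0
  then show ?case by simp
next
  case (Suc t)
  have nat: "of_nat k \<in> poly_ring V" for k and V :: "(nat \<times> nat) set"
    by (induction k) (auto intro: poly_ring_add)
  have "f1' \<in> poly_ring (UNIV \<times> {1..1})" by (simp add: f1'_def)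
  from total_deriv_in_poly_ring[OF this]
  have "total_deriv f1' \<in> poly_ring (UNIV \<times> {1..Suc (Suc t)})"
    by (rule poly_ring_jets_mono) simp
  moreover have "f1' \<in> poly_ring (UNIV \<times> {1..Suc (Suc t)})" by (simp add: f1'_def)
  moreover have "Lambda i t \<in> poly_ring (UNIV \<times> {1..Suc (Suc t)})"
    by (rule poly_ring_jets_mono[OF Suc]) simp
  ultimately show ?case
    using total_deriv_in_poly_ring[OF Suc]
    by (auto simp: bracket_def simp del: of_nat_Suc of_nat_add intro!: poly_ring_diff poly_ring_mult nat)
qed

section \<open>Straightening the first component\<close>

lemma higher_deriv_has_field_derivative:
  assumes "f holomorphic_on UNIV"
  shows "((deriv ^^ s) f has_field_derivative (deriv ^^ Suc s) f \<zeta>) (at \<zeta>)"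
  using holomorphic_higher_deriv[OF assms open_UNIV, of s]
  by (simp add: holomorphic_derivI)

text \<open>The jets of \<open>f\<^sub>i \<circ> f\<^sub>1\<^sup>-\<^sup>1\<close> are the quotients \<open>\<Lambda> / f\<^sub>1'\<^bsup>2\<lambda>-1\<^esup>\<close>: the bracket with \<open>f\<^sub>1'\<close>
  is the numerator of the derivative of such a quotient.\<close>

lemma higher_deriv_straightened:
  assumes f: "\<And>i. f i holomorphic_on UNIV" and U: "open U"
    and g: "\<And>w. w \<in> U \<Longrightarrow> (g has_field_derivative inverse (deriv (f 1) (g w))) (at w)"
    and nz: "\<And>w. w \<in> U \<Longrightarrow> deriv (f 1) (g w) \<noteq> 0"
    and w: "w \<in> U"
  shows "(deriv ^^ Suc t) (f i \<circ> g) w =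
    eval_at (jet f (g w)) (Lambda i t) / deriv (f 1) (g w) ^ (2 * t + 1)"
  using w
proof (induction t arbitrary: w)
  case 0
  have "(f i has_field_derivative deriv (f i) (g w)) (at (g w))"
    using higher_deriv_has_field_derivative[OF f, of 0 i] by simp
  then have "(f i \<circ> g has_field_derivative deriv (f i) (g w) * inverse (deriv (f 1) (g w))) (at w)"
    using g[OF 0] unfolding o_def by (rule DERIV_chain2)
  from DERIV_imp_deriv[OF this] show ?case by (simp add: jet_def divide_inverse o_def)
next
  case (Suc t)
  define E where "E = (\<lambda>P w. eval_at (jet f (g w)) P)"
  have E: "(E P has_field_derivative E (total_deriv P) w * inverse (E f1' w)) (at w)" for P
  proof -
    have "((\<lambda>\<zeta>. eval_at (jet f \<zeta>) P) has_field_derivative eval_at (jet f (g w)) (total_deriv P)) (at (g w))"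
      by (rule eval_at_total_deriv)
         (simp add: jet_def higher_deriv_has_field_derivative[OF f, simplified])
    from DERIV_chain2[OF this g[OF Suc.prems]] show ?thesis by (simp add: E_def jet_def)
  qed
  have nz': "E f1' w \<noteq> 0" using nz[OF Suc.prems] by (simp add: E_def jet_def)
  let ?k = "2 * t + 1"
  have eq: "(deriv ^^ Suc t) (f i \<circ> g) v = E (Lambda i t) v / E f1' v ^ ?k" if "v \<in> U" for v
    using Suc.IH[OF that] by (simp add: E_def jet_def o_def)
  let ?D = "(E (total_deriv (Lambda i t)) w * inverse (E f1' w) * E f1' w ^ ?k -
       E (Lambda i t) w * (of_nat ?k * (E (total_deriv f1') w * inverse (E f1' w)) * E f1' w ^ (?k - 1))) /
       (E f1' w ^ ?k * E f1' w ^ ?k)"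
  have "((\<lambda>v. E (Lambda i t) v / E f1' v ^ ?k) has_field_derivative ?D) (at w)"
  proof (rule DERIV_divide[OF E])
    show "((\<lambda>v. E f1' v ^ ?k) has_field_derivative
        of_nat ?k * (E (total_deriv f1') w * inverse (E f1' w)) * E f1' w ^ (?k - 1)) (at w)"
      using DERIV_power[OF E[of f1'], of ?k] by (simp only: mult.assoc One_nat_def)
  qed (use nz' in simp)
  then have "((deriv ^^ Suc t) (f i \<circ> g) has_field_derivative ?D) (at w)"
    by (rule has_field_derivative_transform_within_open[OF _ U Suc.prems]) (rule eq[symmetric])
  then have "(deriv ^^ Suc (Suc t)) (f i \<circ> g) w = ?D"
    by (simp add: DERIV_imp_deriv)
  \<comment> \<open>With \<open>?k = 2 * t + 1\<close>, the numerator has order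
    \<open>?k - 2\<close> in \<open>f1'\<close> beyond the bracket and the denominator
    \<open>2 * ?k\<close>. The difference \<open>?k + 2\<close> explains why the exponent, like the
    weight, grows by two per bracket.\<close>
  also have "?D = (E (total_deriv (Lambda i t)) w * E f1' w -
      of_nat ?k * E (Lambda i t) w * E (total_deriv f1') w) / E f1' w ^ (2 * Suc t + 1)"
  proof -
    have "(DL * inverse F * F ^ ?k - L * (c * (DF * inverse F) * F ^ (?k - 1))) / (F ^ ?k * F ^ ?k) =
      (DL * F - c * L * DF) / F ^ (2 * Suc t + 1)" if "F \<noteq> 0" for DL F L DF c :: complex
      using that by (simp add: field_simps power_add)
    from this[OF nz'] show ?thesis .
  qed
  also have "E (total_deriv (Lambda i t)) w * E f1' w -
      of_nat ?k * E (Lambda i t) w * E (total_deriv f1') w = E (Lambda i (Suc t)) w"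
    unfolding E_def Lambda.simps bracket_def
    by (simp only: eval_at_diff eval_at_mult eval_at_of_nat of_nat_1 mult_1)
  also have "E f1' w = deriv (f 1) (g w)" by (simp add: E_def jet_def)
  finally show ?case by (simp add: E_def)
qed

text \<open>The reparametrization is the local inverse \<open>g\<close> of the first Taylor germ;
  its derivative at 0 is the inverse of \<open>z (1, 1)\<close>, which accounts for the factor in
  front.\<close>

lemma invariants_straightened:
  assumes n: "n \<ge> 1" "\<kappa> \<ge> 1" and P: "P \<in> invariants n \<kappa> m" and z: "z (1, 1) \<noteq> 0"
  shows "eval_at z P = z (1, 1) ^ m *
    eval_at (\<lambda>(i, s). eval_at z (Lambda i (s - 1)) / z (1, 1) ^ (2 * (s - 1) + 1)) P"
proof -
  define f where "f = taylor_germ \<kappa> z"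
  have f: "f i holomorphic_on S" for i S by (simp add: f_def taylor_germ_holomorphic)
  have f0: "f i 0 = 0" for i by (simp add: f_def)
  have f1: "deriv (f 1) 0 = z (1, 1)"
    using jet_taylor_germ[of 1 \<kappa> z 1] n by (simp add: f_def jet_def)
  obtain r where r: "r > 0" "inj_on (f 1) (ball 0 r)"
    using has_complex_derivative_locally_injective[OF f[of 1 UNIV], of 0] f1 z by auto
  define U where "U = f 1 ` ball 0 r"
  have U: "open U"
    unfolding U_def by (rule open_mapping_thm3[OF f]) (use r in auto)
  obtain g where g: "g holomorphic_on U"
      "\<And>w. w \<in> ball 0 r \<Longrightarrow> deriv (f 1) w * deriv g (f 1 w) = 1"
      "\<And>w. w \<in> ball 0 r \<Longrightarrow> g (f 1 w) = w"
    using holomorphic_has_inverse[OF f[of 1] open_ball r(2)] unfolding U_def by metis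
  have U0: "0 \<in> U" using r(1) f0 unfolding U_def by (metis centre_in_ball image_eqI)
  have g0: "g 0 = 0" using g(3)[of 0] r(1) f0 by simp
  have dg: "deriv (f 1) (g w) * deriv g w = 1" if "w \<in> U" for w
    using that g(2,3) unfolding U_def by auto
  have nz: "deriv (f 1) (g w) \<noteq> 0" if "w \<in> U" for w
    using dg[OF that] by auto
  have g': "(g has_field_derivative inverse (deriv (f 1) (g w))) (at w)" if "w \<in> U" for w
  proof -
    have "deriv g w = inverse (deriv (f 1) (g w))" using dg[OF that] by (simp add: inverse_unique)
    then show ?thesis using holomorphic_derivI[OF g(1) U that] by simp
  qed
  note ring = invariants_in_poly_ring[OF P, unfolded jet_vars_def]
  let ?w = "\<lambda>(i, s). eval_at z (Lambda i (s - 1)) / z (1, 1) ^ (2 * (s - 1) + 1)"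
  have "eval_at (jet (\<lambda>i. f i \<circ> g) 0) P = deriv g 0 ^ m * eval_at (jet f 0) P"
  proof (rule invariantsD[OF P])
    show "f i analytic_on {0}" for i by (simp add: f_def taylor_germ_analytic)
    show "g analytic_on {0}" using g(1) U U0 analytic_at by blast
    show "deriv g 0 \<noteq> 0" using dg[OF U0] by auto
  qed (rule g0)
  also have "eval_at (jet (\<lambda>i. f i \<circ> g) 0) P = eval_at ?w P"
  proof (rule eval_at_cong[OF ring])
    fix x assume x: "x \<in> {1..n} \<times> {1..\<kappa>}"
    then obtain i t where it: "x = (i, Suc t)" "Suc t \<le> \<kappa>"
      by (cases x; case_tac "snd x") auto
    have "Lambda i t \<in> poly_ring (UNIV \<times> {1..\<kappa>})"
      by (rule poly_ring_jets_mono[OF Lambda_in_poly_ring it(2)])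
    then have "eval_at (jet f 0) (Lambda i t) = eval_at z (Lambda i t)"
      unfolding f_def by (rule eval_at_jet_taylor_germ)
    then show "jet (\<lambda>i. f i \<circ> g) 0 x = ?w x"
      using higher_deriv_straightened[where f = f, OF f U g' nz U0, of t i] f1
      by (simp add: it(1) jet_def g0 del: funpow.simps)
  qed
  also have "eval_at (jet f 0) P = eval_at z P"
    unfolding f_def by (rule eval_at_jet_taylor_germ[OF ring])
  finally have "eval_at ?w P = deriv g 0 ^ m * eval_at z P" .
  moreover have "z (1, 1) ^ m * deriv g 0 ^ m = 1"
    using dg[OF U0] unfolding g0 f1 by (simp flip: power_mult_distrib)
  ultimately show ?thesis by (simp flip: mult.assoc)
qed

text \<open>Denominators are cleared by induction over arbitrary polynomials in the jet variables;
  the invariance of \<open>P\<close> enters only at the end.\<close>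

lemma generated_algebra_f1'_multiple:
  assumes n: "n \<ge> 1" "\<kappa> \<ge> 1" and P: "P \<in> invariants n \<kappa> m"
    and f1': "f1' \<in> generated_algebra X"
    and Lambda: "\<And>i t. i \<in> {1..n} \<Longrightarrow> t < \<kappa> \<Longrightarrow> Lambda i t \<in> generated_algebra X"
  shows "\<exists>N. f1' ^ N * P \<in> generated_algebra X"
proof -
  let ?A = "generated_algebra X"
  let ?w = "\<lambda>z (i, s). eval_at z (Lambda i (s - 1)) / z (1, 1) ^ (2 * (s - 1) + 1)"
  \<comment> \<open>\<open>G\<close> is a numerator of \<open>Q\<close> at the straightened jet and
    \<open>N\<close> the exponent of its denominator.\<close>
  have "\<exists>N. \<exists>G\<in>?A. \<forall>z. z (1, 1) \<noteq> 0 \<longrightarrow> eval_at z G = z (1, 1) ^ N * eval_at (?w z) Q"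
    if "Q \<in> generated_algebra (var ` jet_vars n \<kappa>)" for Q
    using that
  proof (induction rule: generated_algebra.induct)
    case (const c)
    then show ?case
      by (intro exI[of _ 0] bexI[of _ "const c"]) (auto intro: generated_algebra.const)
  next
    case (gen Q)
    then obtain i s where Q: "Q = var (i, s)" "i \<in> {1..n}" "s \<in> {1..\<kappa>}"
      by (auto simp: jet_vars_def)
    then have "Lambda i (s - 1) \<in> ?A" by (intro Lambda) auto
    then show ?case
      by (intro exI[of _ "2 * (s - 1) + 1"] bexI[of _ "Lambda i (s - 1)"]) (auto simp: Q(1))
  next
    case (add Q R)
    then obtain N M G H where G: "G \<in> ?A" "\<forall>z. z (1, 1) \<noteq> 0 \<longrightarrow> eval_at z G = z (1, 1) ^ N * eval_at (?w z) Q"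
      and H: "H \<in> ?A" "\<forall>z. z (1, 1) \<noteq> 0 \<longrightarrow> eval_at z H = z (1, 1) ^ M * eval_at (?w z) R"
      by blast
    have "f1' ^ M * G + f1' ^ N * H \<in> ?A"
      using G(1) H(1) f1' by (intro generated_algebra.add generated_algebra.mult generated_algebra_power)
    then show ?case
      using G(2) H(2)
      by (intro exI[of _ "N + M"] bexI[of _ "f1' ^ M * G + f1' ^ N * H"])
         (auto simp: power_add algebra_simps)
  next
    case (mult Q R)
    then obtain N M G H where G: "G \<in> ?A" "\<forall>z. z (1, 1) \<noteq> 0 \<longrightarrow> eval_at z G = z (1, 1) ^ N * eval_at (?w z) Q"
      and H: "H \<in> ?A" "\<forall>z. z (1, 1) \<noteq> 0 \<longrightarrow> eval_at z H = z (1, 1) ^ M * eval_at (?w z) R"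
      by blast
    then show ?case
      by (intro exI[of _ "N + M"] bexI[of _ "G * H"])
         (auto simp: power_add algebra_simps intro: generated_algebra.mult)
  qed
  then obtain N G where G: "G \<in> ?A"
      "\<And>z. z (1, 1) \<noteq> 0 \<Longrightarrow> eval_at z G = z (1, 1) ^ N * eval_at (?w z) P"
    using invariants_in_poly_ring[OF P] unfolding poly_ring_eq_generated_algebra by blast
  \<comment> \<open>Both sides equal the value of \<open>P\<close> at the straightened jet times the
    power \<open>N + m\<close> of \<open>z (1, 1)\<close>.\<close>
  have "f1' ^ N * P = f1' ^ m * G"
  proof (rule eval_at_inject)
    fix z :: "nat \<times> nat \<Rightarrow> complex" assume z: "\<And>x. z x \<noteq> 0"
    show "eval_at z (f1' ^ N * P) = eval_at z (f1' ^ m * G)"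
      unfolding eval_at_mult eval_at_power eval_at_f1' G(2)[OF z]
      by (subst invariants_straightened[where z = z, OF n P z]) (simp add: mult_ac)
  qed
  then show ?thesis using G(1) f1' by (metis generated_algebra.mult generated_algebra_power)
qed

section \<open>The algebra of invariants as a sum of its graded pieces\<close>

lemma invariants_subset_algebra:
  assumes "P \<in> invariants n \<kappa> m"
  shows "P \<in> invariant_algebra n \<kappa>"
proof -
  have "P = (\<Sum>i\<le>m. if i = m then P else 0)" by simp
  moreover have "\<forall>i\<le>m. (if i = m then P else 0) \<in> invariants n \<kappa> i"
    using assms by (auto intro: invariants_0)
  ultimately show ?thesis unfolding invariant_algebra_def by blast
qed

lemma invariant_algebra_add:
  assumes "P \<in> invariant_algebra n \<kappa>" "Q \<in> invariant_algebra n \<kappa>"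
  shows "P + Q \<in> invariant_algebra n \<kappa>"
proof -
  obtain d p where p: "P = (\<Sum>m\<le>d. p m)" "\<forall>m\<le>d. p m \<in> invariants n \<kappa> m"
    using assms(1) by (auto simp: invariant_algebra_def)
  obtain e q where q: "Q = (\<Sum>m\<le>e. q m)" "\<forall>m\<le>e. q m \<in> invariants n \<kappa> m"
    using assms(2) by (auto simp: invariant_algebra_def)
  let ?s = "\<lambda>m. (if m \<le> d then p m else 0) + (if m \<le> e then q m else 0)"
  have extend: "(\<Sum>m\<le>d. p m) = (\<Sum>m\<le>N. if m \<le> d then p m else 0)" if "d \<le> N"
    for d N and p :: "nat \<Rightarrow> jet_poly"
    using that by (intro sum.mono_neutral_cong_left) auto
  have "P + Q = (\<Sum>m\<le>max d e. ?s m)"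
    using extend[of d "max d e" p] extend[of e "max d e" q] by (simp add: p(1) q(1) sum.distrib)
  moreover have "\<forall>m\<le>max d e. ?s m \<in> invariants n \<kappa> m"
    using p(2) q(2) by (auto intro!: invariants_add invariants_0)
  ultimately show ?thesis unfolding invariant_algebra_def by blast
qed

lemma invariant_algebra_sum:
  "(\<And>i. i \<in> I \<Longrightarrow> P i \<in> invariant_algebra n \<kappa>) \<Longrightarrow> sum P I \<in> invariant_algebra n \<kappa>"
  by (induction I rule: infinite_finite_induct)
     (auto intro: invariant_algebra_add invariants_subset_algebra[OF invariants_0])

lemma invariant_algebra_mult:
  assumes "P \<in> invariant_algebra n \<kappa>" "Q \<in> invariant_algebra n \<kappa>"
  shows "P * Q \<in> invariant_algebra n \<kappa>"
proof -
  obtain d p where p: "P = (\<Sum>m\<le>d. p m)" "\<forall>m\<le>d. p m \<in> invariants n \<kappa> m"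
    using assms(1) by (auto simp: invariant_algebra_def)
  obtain e q where q: "Q = (\<Sum>m\<le>e. q m)" "\<forall>m\<le>e. q m \<in> invariants n \<kappa> m"
    using assms(2) by (auto simp: invariant_algebra_def)
  show ?thesis
    unfolding p(1) q(1) sum_product
  proof (intro invariant_algebra_sum)
    fix i j assume "i \<in> {..d}" "j \<in> {..e}"
    then have "p i * q j \<in> invariants n \<kappa> (i + j)"
      using p(2) q(2) by (intro invariants_mult) auto
    then show "p i * q j \<in> invariant_algebra n \<kappa>" by (rule invariants_subset_algebra)
  qed
qed

section \<open>Steps of the algorithm\<close>

lemma generated_algebra_mono:
  assumes "P \<in> generated_algebra X" "X \<subseteq> Y"
  shows "P \<in> generated_algebra Y"
  using assms by induction (auto intro: generated_algebra.intros)

lemma append_new_superset: "set L \<subseteq> set (append_new L Rs)"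
  by (induction Rs arbitrary: L) force+

lemma append_new_nothing:
  "set Rs \<subseteq> generated_algebra (set (f1' # L)) \<Longrightarrow> append_new L Rs = L"
  by (induction Rs) auto

lemma alg_loop_star_superset: "(alg_loop n \<kappa>)\<^sup>*\<^sup>* L L' \<Longrightarrow> set L \<subseteq> set L'"
  by (induction rule: rtranclp_induct) (use append_new_superset in \<open>force simp: alg_loop_def\<close>)+

text \<open>The bracket of \<open>f1'\<close> with itself vanishes, reflecting that the straightened
  first component is the identity. This covers the index 1, which the initial list omits.\<close>

lemma Lambda_1_eq_0: "Lambda 1 (Suc t) = 0"
proof (induction t)
  case 0
  show ?case by (simp add: bracket_def f1'_def)
next
  case (Suc t)
  have "total_deriv 0 = 0" by (simp add: total_deriv_def)
  then show ?case using Suc by (simp add: bracket_def del: of_nat_Suc of_nat_add)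
qed

lemma Lambda_in_initial_list:
  assumes "i \<in> {1..n}" "t < \<kappa>"
  shows "Lambda i t \<in> generated_algebra (set (f1' # initial_list n \<kappa>))"
proof (cases "i = 1")
  case True
  then show ?thesis
  proof (cases t)
    case 0
    then have "Lambda i t = f1'" using True by (simp add: f1'_def)
    then show ?thesis by (auto intro: generated_algebra.gen)
  next
    case (Suc t')
    then show ?thesis using True Lambda_1_eq_0 generated_algebra_0 by simp
  qed
next
  case False
  then have i: "i \<in> {2..<n + 1}" using assms by auto
  have "Lambda i t \<in> set (initial_list n \<kappa>)"
  proof (cases t)
    case 0
    then have "Lambda i t \<in> set (map (\<lambda>i. var (i, 1)) [2..<n + 1])"
      using i unfolding set_map by (intro rev_image_eqI) auto
    then show ?thesis unfolding initial_list_def set_append by blast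
  next
    case (Suc t')
    then have "Suc t \<in> set [2..<\<kappa> + 1]" using assms by auto
    then have "Lambda i t \<in> set (map (\<lambda>s. Lambda i (s - 1)) [2..<\<kappa> + 1])"
      unfolding set_map by (rule rev_image_eqI) simp
    moreover have "map (\<lambda>s. Lambda i (s - 1)) [2..<\<kappa> + 1] \<in>
        set (map (\<lambda>i. map (\<lambda>s. Lambda i (s - 1)) [2..<\<kappa> + 1]) [2..<n + 1])"
      using i unfolding set_map[of _ "[2..<n + 1]"] by (intro imageI) auto
    ultimately show ?thesis
      unfolding initial_list_def set_append set_concat by (intro UnI2 UN_I)
  qed
  then show ?thesis by (auto intro: generated_algebra.gen)
qed

text \<open>A power of \<open>f1'\<close> is a single monomial and shifts all exponents. The bound
  ensures that the maximal power demanded by \<open>f1'_quotient\<close> exists.\<close>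

lemma f1'_power_dvd_bound:
  assumes "f1' ^ \<mu> dvd Q" "b \<in> Poly_Mapping.keys Q"
  shows "\<mu> \<le> Poly_Mapping.lookup b (1, 1)"
proof -
  obtain R where R: "Q = f1' ^ \<mu> * R" using assms(1) by auto
  have "f1' ^ \<mu> = Poly_Mapping.single (Poly_Mapping.single (1, 1) \<mu>) 1"
    by (rule eval_at_inject) simp
  then obtain c where "b = Poly_Mapping.single (1, 1) \<mu> + c"
    using assms(2) keys_mult[of "f1' ^ \<mu>" R] by (auto simp: R)
  then show ?thesis by (simp add: lookup_add)
qed

lemma f1'_quotient_exists:
  assumes "Q = f1' * R"
  shows "\<exists>R. f1'_quotient Q R"
proof (cases "Q = 0")
  case True
  then show ?thesis by (auto simp: f1'_quotient_def)
next
  case False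
  then obtain b where b: "b \<in> Poly_Mapping.keys Q"
    by (metis ex_in_conv keys_eq_empty)
  let ?D = "\<lambda>\<mu>. f1' ^ \<mu> dvd Q"
  have 1: "?D 1" using assms by simp
  have bound: "\<And>\<mu>. ?D \<mu> \<Longrightarrow> \<mu> \<le> Poly_Mapping.lookup b (1, 1)"
    using b by (rule f1'_power_dvd_bound[rotated])
  define \<nu> where "\<nu> = Greatest ?D"
  have "?D \<nu>" unfolding \<nu>_def by (rule GreatestI_nat[where P = ?D, OF 1 bound])
  moreover have le: "\<mu> \<le> \<nu>" if "?D \<mu>" for \<mu>
    unfolding \<nu>_def by (rule Greatest_le_nat[where P = ?D, OF that bound])
  ultimately obtain R' where "Q = f1' ^ \<nu> * R'" by blast
  moreover have "\<nu> \<ge> 1" using le[OF 1] .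
  ultimately show ?thesis using False le unfolding f1'_quotient_def by metis
qed

section \<open>Lists of invariants without new relations\<close>

lemma list_subst_in_generated_algebra:
  assumes "S \<in> poly_ring {..<length L}"
  shows "list_subst L S \<in> generated_algebra (set L)"
proof -
  have "(\<lambda>j. L ! j) ` {..<length L} = set L" by (auto simp: set_conv_nth)
  then show ?thesis using subst_in_generated_algebra[OF assms, of "\<lambda>j. L ! j"]
    by (simp add: list_subst_def)
qed

lemma restrict0_list_subst:
  assumes "S \<in> poly_ring {..<length L}"
  shows "restrict0 (list_subst L S) = list_subst (map restrict0 L) S"
proof (rule eval_at_inject)
  fix z :: "nat \<times> nat \<Rightarrow> complex"
  show "eval_at z (restrict0 (list_subst L S)) = eval_at z (list_subst (map restrict0 L) S)"
    unfolding eval_at_restrict0 list_subst_def eval_at_subst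
    by (rule eval_at_cong[OF assms]) simp
qed

lemma relations0_iff:
  "S \<in> relations0 L \<longleftrightarrow> S \<in> poly_ring {..<length L} \<and> restrict0 (list_subst L S) = 0"
  by (auto simp: relations0_def restrict0_list_subst)

text \<open>Comparison of the coefficients of \<open>t ^ m\<close> between polynomials in one
  variable, indexed by the unit type. The value \<open>t = 0\<close> may be left out because
  \<open>eval_at_inject\<close> tests nonzero points only.\<close>

lemma homogeneous_part_eqI:
  fixes u :: "'b \<Rightarrow> complex"
  assumes "finite B" "\<And>t. t \<noteq> 0 \<Longrightarrow> (\<Sum>b\<in>B. u b * t ^ w b) = p * t ^ m"
  shows "(\<Sum>b | b \<in> B \<and> w b = m. u b) = p"
proof -
  let ?P = "\<Sum>b\<in>B. Poly_Mapping.single (Poly_Mapping.single () (w b)) (u b)"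
  have eq: "?P = Poly_Mapping.single (Poly_Mapping.single () m) p"
    by (rule eval_at_inject) (simp add: assms(2))
  have "Poly_Mapping.single () j = Poly_Mapping.single () k \<longleftrightarrow> j = k" for j k :: nat
    by (metis lookup_single_eq)
  then have "Poly_Mapping.lookup ?P (Poly_Mapping.single () m) = (\<Sum>b\<in>B. if w b = m then u b else 0)"
    unfolding lookup_sum by (simp add: lookup_single when_def)
  then show ?thesis using assms(1) unfolding eq by (simp add: sum.inter_filter)
qed

text \<open>\<open>initial\<close> records what the run of loops contributes, and
  \<open>weights_pos\<close> what mutual independence contributes.\<close>

locale closed_list =
  fixes n \<kappa> :: nat and L :: "jet_poly list" and l :: "nat list"
    and r :: "(nat monom \<times> nat monom) set" and Ss :: "nat cpoly list"
  assumes n: "n \<ge> 1" "\<kappa> \<ge> 1"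
    and initial: "set (initial_list n \<kappa>) \<subseteq> set L"
    and weights: "has_weights n \<kappa> L l"
    and weights_pos: "\<And>j. j < length L \<Longrightarrow> l ! j \<noteq> 0"
    and order: "monomial_order (length L) r"
    and basis: "reduced_groebner_basis (length L) r (relations0 L) (set Ss)"
    and closing: "\<And>S. S \<in> set Ss \<Longrightarrow> \<exists>R\<in>poly_ring {..<Suc (length L)}.
      list_subst L S = f1' * list_subst (f1' # L) R"
begin

abbreviation "\<A> \<equiv> generated_algebra (set (f1' # L))"
abbreviation "exponents \<equiv> normal_exponents l r Ss"

section \<open>Saturation of the generated algebra with respect to \<open>f1'\<close>\<close>

lemma length_l: "length l = length L"
  using weights by (simp add: has_weights_def)

lemma f1'_in: "f1' \<in> \<A>"
  by (auto intro: generated_algebra.gen)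

lemma list_subst_in: "S \<in> poly_ring {..<length L} \<Longrightarrow> list_subst L S \<in> \<A>"
  by (rule generated_algebra_mono[OF list_subst_in_generated_algebra]) auto

text \<open>The relations with this property contain the basis and are closed under sums and
  polynomial multiples, so \<open>groebner_basis_induct\<close> applies.\<close>

lemma relation_divisible:
  assumes "S \<in> relations0 L"
  shows "\<exists>Q\<in>\<A>. list_subst L S = f1' * Q"
proof -
  let ?J = "{S \<in> relations0 L. \<exists>Q\<in>\<A>. list_subst L S = f1' * Q}"
  have diff: "p - q \<in> relations0 L" if "p \<in> relations0 L" "q \<in> relations0 L" for p q
    using that by (auto simp: relations0_def list_subst_def subst_diff intro: poly_ring_diff)
  have "S \<in> ?J"
  proof (rule groebner_basis_induct[OF order basis])
    show "0 \<in> ?J"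
      by (auto simp: relations0_def list_subst_def intro!: bexI[of _ 0] generated_algebra_0)
    show "p + q \<in> ?J" if p: "p \<in> ?J" and q: "q \<in> ?J" for p q
    proof -
      have "p + q \<in> relations0 L"
        using p q by (auto simp: relations0_def list_subst_def subst_add intro: poly_ring_add)
      moreover obtain P Q where "P \<in> \<A>" "Q \<in> \<A>" "list_subst L p = f1' * P" "list_subst L q = f1' * Q"
        using p q by blast
      then have "P + Q \<in> \<A>" "list_subst L (p + q) = f1' * (P + Q)"
        by (auto simp: list_subst_def subst_add distrib_left intro: generated_algebra.add)
      ultimately show ?thesis by blast
    qed
    show "p * S \<in> ?J" if S: "S \<in> set Ss" and p: "p \<in> poly_ring {..<length L}" for S p
    proof -
      have "S \<in> relations0 L" using S basis by (auto simp: reduced_groebner_basis_def)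
      then have "p * S \<in> relations0 L"
        using p by (auto simp: relations0_def list_subst_def subst_mult intro: poly_ring_mult)
      moreover obtain R where R: "R \<in> poly_ring {..<Suc (length L)}"
          "list_subst L S = f1' * list_subst (f1' # L) R"
        using closing[OF S] by blast
      have "list_subst (f1' # L) R \<in> \<A>"
        by (rule list_subst_in_generated_algebra) (use R(1) in simp)
      then have "list_subst L p * list_subst (f1' # L) R \<in> \<A>"
        by (rule generated_algebra.mult[OF list_subst_in[OF p]])
      moreover have "list_subst L (p * S) = f1' * (list_subst L p * list_subst (f1' # L) R)"
        using R(2) by (simp add: list_subst_def subst_mult mult_ac)
      ultimately show ?thesis by blast
    qed
  qed (use assms diff in \<open>auto simp: relations0_def\<close>)
  then show ?thesis by blast
qed

lemma algebra_split:
  assumes "P \<in> \<A>"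
  shows "\<exists>S\<in>poly_ring {..<length L}. \<exists>T\<in>\<A>. P = list_subst L S + f1' * T"
  using assms
proof (induction rule: generated_algebra.induct)
  case (const c)
  then show ?case
    by (intro bexI[of _ "const c"] bexI[of _ 0]) (auto simp: list_subst_def generated_algebra_0)
next
  case (gen P)
  show ?case
  proof (cases "P = f1'")
    case True
    have "1 \<in> \<A>" by (metis const_1 generated_algebra.const)
    then show ?thesis using True by (intro bexI[of _ 0] bexI[of _ 1]) (auto simp: list_subst_def)
  next
    case False
    then obtain j where "j < length L" "P = L ! j" using gen by (auto simp: in_set_conv_nth)
    then show ?thesis
      by (intro bexI[of _ "var j"] bexI[of _ 0]) (auto simp: list_subst_def generated_algebra_0)
  qed
next
  case (add P Q)
  then obtain S T S' T' where *: "S \<in> poly_ring {..<length L}" "T \<in> \<A>" "P = list_subst L S + f1' * T"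
    "S' \<in> poly_ring {..<length L}" "T' \<in> \<A>" "Q = list_subst L S' + f1' * T'" by blast
  then have "P + Q = list_subst L (S + S') + f1' * (T + T')"
    by (simp add: list_subst_def subst_add algebra_simps)
  then show ?case using * by (blast intro: poly_ring_add generated_algebra.add)
next
  case (mult P Q)
  then obtain S T S' T' where *: "S \<in> poly_ring {..<length L}" "T \<in> \<A>" "P = list_subst L S + f1' * T"
    "S' \<in> poly_ring {..<length L}" "T' \<in> \<A>" "Q = list_subst L S' + f1' * T'" by blast
  then have "P * Q = list_subst L (S * S') + f1' * (list_subst L S * T' + T * Q)"
    by (simp add: list_subst_def subst_mult algebra_simps)
  moreover have "list_subst L S * T' + T * Q \<in> \<A>"
    using * list_subst_in mult.hyps by (blast intro: generated_algebra.add generated_algebra.mult)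
  ultimately show ?case using * by (blast intro: poly_ring_mult)
qed

text \<open>\<open>Q\<close> is an arbitrary polynomial here, so the same saturation property serves
  for invariants and for the quotients arising in a further loop.\<close>

lemma divide_f1'_in:
  assumes "f1' * Q \<in> \<A>"
  shows "Q \<in> \<A>"
proof -
  obtain S T where S: "S \<in> poly_ring {..<length L}" "T \<in> \<A>" "f1' * Q = list_subst L S + f1' * T"
    using algebra_split[OF assms] by blast
  have "restrict0 (list_subst L S + f1' * T) = 0"
    by (simp add: restrict0_mult flip: S(3))
  then have "S \<in> relations0 L" using S(1) by (simp add: relations0_iff restrict0_add restrict0_mult)
  then obtain T' where T': "T' \<in> \<A>" "list_subst L S = f1' * T'"
    using relation_divisible by blast
  then have "f1' * Q = f1' * (T' + T)" using S(3) by (simp add: distrib_left)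
  then have "Q = T' + T" by (rule f1'_cancel)
  then show ?thesis using T'(1) S(2) by (simp add: generated_algebra.add)
qed

lemma divide_f1'_power_in: "f1' ^ k * Q \<in> \<A> \<Longrightarrow> Q \<in> \<A>"
proof (induction k)
  case (Suc k)
  then show ?case using divide_f1'_in[of "f1' ^ k * Q"] by (simp only: power_Suc mult.assoc)
qed (simp only: power_0 mult_1)

lemma invariants_in:
  assumes "P \<in> invariants n \<kappa> m"
  shows "P \<in> \<A>"
proof -
  have "Lambda i t \<in> \<A>" if "i \<in> {1..n}" "t < \<kappa>" for i t
    using Lambda_in_initial_list[OF that] by (rule generated_algebra_mono) (use initial in auto)
  then obtain N where "f1' ^ N * P \<in> \<A>"
    using generated_algebra_f1'_multiple[OF n assms f1'_in] by blast
  then show ?thesis by (rule divide_f1'_power_in)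
qed

lemma invariant_algebra_eq: "invariant_algebra n \<kappa> = \<A>"
proof (intro equalityI subsetI)
  fix P assume "P \<in> invariant_algebra n \<kappa>"
  then show "P \<in> \<A>"
    unfolding invariant_algebra_def using invariants_in by (blast intro: generated_algebra_sum)
next
  fix P assume "P \<in> \<A>"
  then show "P \<in> invariant_algebra n \<kappa>"
  proof induction
    case (gen P)
    then show ?case
      using f1'_invariant[OF n] weights
      by (auto simp: has_weights_def in_set_conv_nth intro: invariants_subset_algebra)
  qed (auto intro: invariants_subset_algebra invariants_const invariant_algebra_add
         invariant_algebra_mult)
qed

text \<open>A further loop may use another order and another basis. Each relation still evaluates
  into \<open>\<A>\<close>, and saturation brings its quotient into \<open>\<A>\<close> as well.
  That a loop can be performed follows from \<open>closing\<close>, which supplies a factor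
  \<open>f1'\<close>.\<close>

lemma terminates: "homogeneous_reduced_basis L l r Ss \<Longrightarrow> terminates_at n \<kappa> L"
  unfolding terminates_at_def
proof (intro conjI allI impI)
  assume hom: "homogeneous_reduced_basis L l r Ss"
  have "\<forall>S\<in>set Ss. \<exists>R. f1'_quotient (list_subst L S) R"
    using closing f1'_quotient_exists by blast
  then obtain R where "\<forall>S\<in>set Ss. f1'_quotient (list_subst L S) (R S)" by metis
  then have "list_all2 (\<lambda>S R. f1'_quotient (list_subst L S) R) Ss (map R Ss)"
    by (simp add: list_all2_conv_all_nth)
  then show "\<exists>L'. alg_loop n \<kappa> L L'"
    using weights hom unfolding alg_loop_def by blast
next
  fix L' assume "alg_loop n \<kappa> L L'"
  then obtain r' Ss' Rs where loop: "reduced_groebner_basis (length L) r' (relations0 L) (set Ss')"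
      "list_all2 (\<lambda>S R. f1'_quotient (list_subst L S) R) Ss' Rs" "L' = append_new L Rs"
    by (auto simp: alg_loop_def homogeneous_reduced_basis_def)
  have "R \<in> \<A>" if R: "R \<in> set Rs" for R
  proof -
    obtain S where S: "S \<in> set Ss'" "f1'_quotient (list_subst L S) R"
      using loop(2) R by (metis in_set_conv_nth list_all2_conv_all_nth)
    have "S \<in> poly_ring {..<length L}"
      using loop(1) S(1) by (auto simp: reduced_groebner_basis_def relations0_def)
    then have "list_subst L S \<in> \<A>" by (rule list_subst_in)
    then show ?thesis
      using S(2) divide_f1'_power_in generated_algebra_0
      by (auto simp: f1'_quotient_def split: if_splits)
  qed
  then show "L' = L" unfolding loop(3) by (intro append_new_nothing) auto
qed

section \<open>Existence and uniqueness of normal forms\<close>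

definition normal_part :: "nat \<Rightarrow> (nat monom \<Rightarrow> complex) \<Rightarrow> nat cpoly" where
  "normal_part d c = (\<Sum>b\<in>exponents d. Poly_Mapping.single b (c b))"

text \<open>Positive weights bound every exponent by \<open>d\<close>. A sum over an infinite index
  set would be 0 by convention, so the normal sums depend on this.\<close>

lemma finite_exponents: "finite (exponents d)"
proof (rule finite_imageD)
  let ?F = "{f. \<forall>x. (x \<in> {..<length L} \<longrightarrow> f x \<in> {..d}) \<and> (x \<notin> {..<length L} \<longrightarrow> f x = (0::nat))}"
  have "Poly_Mapping.lookup b \<in> ?F" if b: "b \<in> exponents d" for b
  proof -
    have keys: "Poly_Mapping.keys b \<subseteq> {..<length L}" and w: "monom_weight l b = d"
      using b by (auto simp: normal_exponents_def monoms_def length_l)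
    have "Poly_Mapping.lookup b j \<le> d" if j: "j < length L" for j
    proof (cases "j \<in> Poly_Mapping.keys b")
      case True
      have "Poly_Mapping.lookup b j \<le> l ! j * Poly_Mapping.lookup b j"
        using weights_pos[OF j] by simp
      also have "\<dots> \<le> monom_weight l b"
        unfolding monom_weight_def using True by (intro member_le_sum) auto
      finally show ?thesis using w by simp
    qed (simp add: in_keys_iff)
    moreover have "Poly_Mapping.lookup b j = 0" if "j \<notin> {..<length L}" for j
      using keys that by (auto simp: in_keys_iff)
    ultimately show ?thesis by auto
  qed
  moreover have "finite ?F" by (rule finite_set_of_finite_funs) auto
  ultimately show "finite (Poly_Mapping.lookup ` exponents d)"
    by (rule_tac finite_subset[of _ ?F]) auto
  show "inj_on Poly_Mapping.lookup (exponents d)"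
    by (auto intro: inj_onI poly_mapping_eqI)
qed

lemma exponents_monoms: "exponents d \<subseteq> monoms {..<length L}"
  by (auto simp: normal_exponents_def length_l)

lemma normal_part_in_poly_ring: "normal_part d c \<in> poly_ring {..<length L}"
  unfolding normal_part_def using exponents_monoms
  by (intro poly_ring_sum poly_ring_single) auto

lemma lookup_normal_part: "Poly_Mapping.lookup (normal_part d c) b = (if b \<in> exponents d then c b else 0)"
  by (simp add: normal_part_def lookup_sum lookup_single when_def finite_exponents)

lemma list_subst_normal_part:
  "list_subst L (normal_part d c) =
    (\<Sum>b\<in>exponents d. const (c b) * (\<Prod>j<length L. (L ! j) ^ Poly_Mapping.lookup b j))"
  unfolding normal_part_def list_subst_def subst_sum subst_single
proof (intro sum.cong refl arg_cong2[where f = "(*)"])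
  fix b assume "b \<in> exponents d"
  then have "Poly_Mapping.keys b \<subseteq> {..<length L}"
    using exponents_monoms by (auto simp: monoms_def)
  then show "monom_eval ((!) L) b = (\<Prod>j<length L. (L ! j) ^ Poly_Mapping.lookup b j)"
    by (intro monom_eval_superset) auto
qed

lemma normal_sum_eq:
  "normal_sum L l r Ss m cf = (\<Sum>a\<le>m. f1' ^ a * list_subst L (normal_part (m - a) (cf a)))"
  by (simp add: normal_sum_def list_subst_normal_part)

lemma normal_sum_Suc:
  "normal_sum L l r Ss (Suc m) cf =
    list_subst L (normal_part (Suc m) (cf 0)) + f1' * normal_sum L l r Ss m (\<lambda>a. cf (Suc a))"
  unfolding normal_sum_eq by (subst sum.atMost_Suc_shift) (simp add: sum_distrib_left mult.assoc)

lemma normal_sum_0: "normal_sum L l r Ss 0 cf = list_subst L (normal_part 0 (cf 0))"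
  by (simp add: normal_sum_eq)

lemma normal_part_invariant: "list_subst L (normal_part d c) \<in> invariants n \<kappa> d"
  unfolding list_subst_normal_part
proof (intro invariants_sum invariants_const_mult)
  fix b assume b: "b \<in> exponents d"
  have "(\<Prod>j<length L. (L ! j) ^ Poly_Mapping.lookup b j) \<in>
      invariants n \<kappa> (\<Sum>j<length L. l ! j * Poly_Mapping.lookup b j)"
    using weights by (intro invariants_prod invariants_power) (auto simp: has_weights_def)
  also have "(\<Sum>j<length L. l ! j * Poly_Mapping.lookup b j) = monom_weight l b"
    unfolding monom_weight_def using b exponents_monoms
    by (intro sum.mono_neutral_right) (auto simp: monoms_def in_keys_iff)
  also have "\<dots> = d" using b by (simp add: normal_exponents_def)
  finally show "(\<Prod>j<length L. (L ! j) ^ Poly_Mapping.lookup b j) \<in> invariants n \<kappa> d" .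
qed

lemma normal_sum_invariant: "normal_sum L l r Ss m cf \<in> invariants n \<kappa> m"
  unfolding normal_sum_eq
proof (rule invariants_sum)
  fix a assume a: "a \<in> {..m}"
  have "f1' ^ a * list_subst L (normal_part (m - a) (cf a)) \<in> invariants n \<kappa> (1 * a + (m - a))"
    by (intro invariants_mult invariants_power f1'_invariant n normal_part_invariant)
  then show "f1' ^ a * list_subst L (normal_part (m - a) (cf a)) \<in> invariants n \<kappa> m"
    using a by simp
qed

text \<open>Homogeneity of the invariants lets one discard, from a normal form of the restriction,
  all terms of weight other than \<open>m\<close>.\<close>

lemma invariant_restriction_normal:
  assumes P: "P \<in> invariants n \<kappa> m"
  shows "\<exists>c. (\<forall>b. b \<notin> exponents m \<longrightarrow> c b = 0) \<and>
    restrict0 P = restrict0 (list_subst L (normal_part m c))"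
proof -
  obtain S T where S: "S \<in> poly_ring {..<length L}" "P = list_subst L S + f1' * T"
    using algebra_split[OF invariants_in[OF P]] by blast
  obtain N where N: "Poly_Mapping.keys N \<subseteq> monoms {..<length L} -
        (\<Union>S\<in>set Ss. multiples (length L) (leading_monom r S))" "S - N \<in> relations0 L"
  proof -
    have "\<exists>N. Poly_Mapping.keys N \<subseteq> monoms {..<length L} -
        (\<Union>S\<in>set Ss. multiples (length L) (leading_monom r S)) \<and> S - N \<in> relations0 L"
      using basis S(1)
      by (intro normal_form_exists[OF order])
         (auto simp: reduced_groebner_basis_def relations0_def list_subst_def subst_add subst_mult
            intro: poly_ring_add poly_ring_mult)
    then show thesis using that by blast
  qed
  have NR: "N \<in> poly_ring {..<length L}" using N(1) by (auto simp: poly_ring_def)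
  have eval_N: "eval_at z P = eval_at z (list_subst L N)" if "z (1, 1) = 0" for z
  proof -
    have "eval_at z (restrict0 (list_subst L (S - N))) = 0"
      using N(2) by (simp add: relations0_iff)
    moreover have "z((1, 1) := 0) = z" using that by auto
    ultimately show ?thesis using that by (simp add: S(2) list_subst_def subst_diff)
  qed
  define c where "c b = (if b \<in> exponents m then Poly_Mapping.lookup N b else 0)" for b
  have "restrict0 P = restrict0 (list_subst L (normal_part m c))"
  proof (rule eval_at_inject)
    fix z :: "nat \<times> nat \<Rightarrow> complex"
    \<comment> \<open>Dilating \<open>y\<close> keeps its coordinate \<open>(1, 1)\<close> equal to
      0, so \<open>eval_N\<close> holds along the whole curve and the terms of \<open>N\<close> are
      sorted by powers of \<open>t\<close>.\<close>
    define y where "y = z((1, 1) := 0)"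
    let ?y = "\<lambda>t (i, s). t ^ s * y (i, s)"
    let ?u = "\<lambda>b. Poly_Mapping.lookup N b * monom_eval (\<lambda>j. eval_at y (L ! j)) b"
    have scale: "monom_eval (\<lambda>j. eval_at (?y t) (L ! j)) b =
        monom_eval (\<lambda>j. eval_at y (L ! j)) b * t ^ monom_weight l b"
      if t: "t \<noteq> 0" and b: "b \<in> monoms {..<length L}" for t b
    proof -
      have "eval_at (?y t) (L ! j) = t ^ (l ! j) * eval_at y (L ! j)"
        if "j \<in> Poly_Mapping.keys b" for j
        using that b weights
        by (intro invariants_weighted_homogeneous[OF _ t, of _ n \<kappa>]) (auto simp: monoms_def has_weights_def)
      then have "monom_eval (\<lambda>j. eval_at (?y t) (L ! j)) b =
          (\<Prod>j\<in>Poly_Mapping.keys b. t ^ (l ! j * Poly_Mapping.lookup b j) *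
             eval_at y (L ! j) ^ Poly_Mapping.lookup b j)"
        unfolding monom_eval_def by (intro prod.cong) (auto simp: power_mult_distrib power_mult)
      then show ?thesis
        by (simp add: prod.distrib monom_eval_def monom_weight_def power_sum mult_ac)
    qed
    have "(\<Sum>b | b \<in> Poly_Mapping.keys N \<and> monom_weight l b = m. ?u b) = eval_at y P"
    proof (rule homogeneous_part_eqI)
      fix t :: complex assume t: "t \<noteq> 0"
      have "(\<Sum>b\<in>Poly_Mapping.keys N. ?u b * t ^ monom_weight l b) = eval_at (?y t) (list_subst L N)"
        unfolding list_subst_def eval_at_subst eval_at_eq[of _ N]
        using scale[OF t] N(1) by (intro sum.cong) auto
      also have "\<dots> = eval_at (?y t) P" by (rule eval_N[symmetric]) (simp add: y_def)
      also have "\<dots> = eval_at y P * t ^ m"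
        using invariants_weighted_homogeneous[OF P t, of y] by simp
      finally show "(\<Sum>b\<in>Poly_Mapping.keys N. ?u b * t ^ monom_weight l b) = eval_at y P * t ^ m" .
    qed simp
    also have "(\<Sum>b | b \<in> Poly_Mapping.keys N \<and> monom_weight l b = m. ?u b) =
        (\<Sum>b\<in>exponents m. c b * monom_eval (\<lambda>j. eval_at y (L ! j)) b)"
      using N(1) by (intro sum.mono_neutral_cong_left finite_exponents)
        (auto simp: normal_exponents_def length_l c_def in_keys_iff)
    also have "\<dots> = eval_at y (list_subst L (normal_part m c))"
      by (simp add: list_subst_def normal_part_def)
    finally show "eval_at z (restrict0 P) = eval_at z (restrict0 (list_subst L (normal_part m c)))"
      by (simp add: y_def fun_upd_def)
  qed
  then show ?thesis by (intro exI[of _ c]) (auto simp: c_def)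
qed

text \<open>Subtracting the normal part leaves an invariant that vanishes where \<open>f1'\<close>
  does. Invariance is stated for \<open>f1' * Q\<close> only, as for \<open>m = 0\<close> there is
  no weight left for \<open>Q\<close>.\<close>

lemma invariant_split:
  assumes P: "P \<in> invariants n \<kappa> m"
  shows "\<exists>c Q. (\<forall>b. b \<notin> exponents m \<longrightarrow> c b = 0) \<and> Q \<in> poly_ring (jet_vars n \<kappa>) \<and>
    P = list_subst L (normal_part m c) + f1' * Q \<and> f1' * Q \<in> invariants n \<kappa> m"
proof -
  obtain c where c: "\<forall>b. b \<notin> exponents m \<longrightarrow> c b = 0"
    "restrict0 P = restrict0 (list_subst L (normal_part m c))"
    using invariant_restriction_normal[OF P] by blast
  let ?D = "P - list_subst L (normal_part m c)"
  have D: "?D \<in> invariants n \<kappa> m" by (rule invariants_diff[OF P normal_part_invariant])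
  have "restrict0 ?D = 0" using c(2) by (simp add: restrict0_def subst_diff)
  then obtain Q where Q: "Q \<in> poly_ring (jet_vars n \<kappa>)" "?D = f1' * Q"
    using f1'_divides_diff_restrict0[OF invariants_in_poly_ring[OF D]] by auto
  then have "P = list_subst L (normal_part m c) + f1' * Q" by (simp add: algebra_simps)
  then show ?thesis using c(1) Q D by metis
qed

lemma normal_sum_exists:
  "P \<in> invariants n \<kappa> m \<Longrightarrow>
    \<exists>cf. (\<forall>a b. \<not> (a \<le> m \<and> b \<in> exponents (m - a)) \<longrightarrow> cf a b = 0) \<and> P = normal_sum L l r Ss m cf"
proof (induction m arbitrary: P)
  case 0
  obtain c Q where c: "\<forall>b. b \<notin> exponents 0 \<longrightarrow> c b = 0"
      "P = list_subst L (normal_part 0 c) + f1' * Q" "f1' * Q \<in> invariants n \<kappa> 0"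
    using invariant_split[OF 0] by blast
  \<comment> \<open>A multiple of \<open>f1'\<close> that is constant must vanish, as its value at
    the origin shows.\<close>
  obtain k where k: "f1' * Q = const k" using invariants_0_const[OF c(3)] by blast
  have "eval_at (\<lambda>_. 0) (f1' * Q) = eval_at (\<lambda>_. 0) (const k :: jet_poly)" by (rule arg_cong[OF k])
  then have "k = 0" by simp
  then have "f1' * Q = 0" using k by simp
  then show ?case using c(1,2)
    by (intro exI[of _ "\<lambda>a b. if a = 0 then c b else 0"]) (auto simp: normal_sum_0)
next
  case (Suc m)
  obtain c Q where c: "\<forall>b. b \<notin> exponents (Suc m) \<longrightarrow> c b = 0" "Q \<in> poly_ring (jet_vars n \<kappa>)"
      "P = list_subst L (normal_part (Suc m) c) + f1' * Q" "f1' * Q \<in> invariants n \<kappa> (Suc m)"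
    using invariant_split[OF Suc.prems] by blast
  have "Q \<in> invariants n \<kappa> m" using invariants_divide_f1'[OF n c(2,4)] .
  then obtain cf where cf: "\<forall>a b. \<not> (a \<le> m \<and> b \<in> exponents (m - a)) \<longrightarrow> cf a b = 0"
      "Q = normal_sum L l r Ss m cf"
    using Suc.IH by blast
  \<comment> \<open>\<open>case_nat\<close> puts \<open>c\<close> in front: the factor
    \<open>f1'\<close> before \<open>Q\<close> shifts every exponent of \<open>f1'\<close> by
    one.\<close>
  show ?case
    using c(1,3) cf
    by (intro exI[of _ "case_nat c cf"]) (auto simp: normal_sum_Suc split: nat.split)
qed

lemma normal_part_inject:
  assumes "restrict0 (list_subst L (normal_part d c)) = restrict0 (list_subst L (normal_part d c'))"
  shows "normal_part d c = normal_part d c'"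
proof -
  let ?N = "normal_part d c - normal_part d c'"
  have "?N \<in> relations0 L"
    using assms normal_part_in_poly_ring
    by (auto simp: relations0_iff list_subst_def restrict0_def subst_diff intro: poly_ring_diff)
  moreover have "Poly_Mapping.keys ?N \<subseteq> exponents d"
    by (auto simp: in_keys_iff lookup_minus lookup_normal_part split: if_splits)
  then have "Poly_Mapping.keys ?N \<subseteq>
      monoms {..<length L} - (\<Union>S\<in>set Ss. multiples (length L) (leading_monom r S))"
    by (auto simp: normal_exponents_def length_l)
  ultimately have "?N = 0" by (rule normal_relation_eq_0[OF order basis])
  then show ?thesis by simp
qed

text \<open>Restriction isolates the terms free of \<open>f1'\<close>; once these agree,
  \<open>f1'\<close> cancels and the weight drops by one.\<close>

lemma normal_sum_inject:
  "normal_sum L l r Ss m cf = normal_sum L l r Ss m cf' \<Longrightarrow> a \<le> m \<Longrightarrow> b \<in> exponents (m - a) \<Longrightarrow>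
    cf a b = cf' a b"
proof (induction m arbitrary: cf cf' a)
  case 0
  then have "normal_part 0 (cf 0) = normal_part 0 (cf' 0)"
    by (intro normal_part_inject) (simp add: normal_sum_0)
  then show ?case using 0 lookup_normal_part[of 0 _ b] by (metis diff_self_eq_0 le_zero_eq)
next
  case (Suc m)
  have "restrict0 (normal_sum L l r Ss (Suc m) cf) = restrict0 (normal_sum L l r Ss (Suc m) cf')"
    using Suc.prems(1) by simp
  then have eq: "normal_part (Suc m) (cf 0) = normal_part (Suc m) (cf' 0)"
    by (intro normal_part_inject) (simp add: normal_sum_Suc restrict0_add restrict0_mult)
  have "f1' * normal_sum L l r Ss m (\<lambda>a. cf (Suc a)) = f1' * normal_sum L l r Ss m (\<lambda>a. cf' (Suc a))"
    using Suc.prems(1) by (simp add: normal_sum_Suc eq)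
  then have rest: "normal_sum L l r Ss m (\<lambda>a. cf (Suc a)) = normal_sum L l r Ss m (\<lambda>a. cf' (Suc a))"
    by (rule f1'_cancel)
  show ?case
  proof (cases a)
    case 0
    then show ?thesis
      using Suc.prems(3) eq lookup_normal_part[of "Suc m" _ b] by (metis diff_zero)
  next
    case (Suc a')
    then show ?thesis using Suc.IH[OF rest, of a'] Suc.prems by simp
  qed
qed

text \<open>Coefficients at inadmissible places are fixed to be 0, so that uniqueness of the
  expansion becomes equality of functions.\<close>

lemma normal_sum_exists_unique:
  assumes "P \<in> invariants n \<kappa> m"
  shows "\<exists>!cf. (\<forall>a b. \<not> (a \<le> m \<and> b \<in> exponents (m - a)) \<longrightarrow> cf a b = 0) \<and>
    P = normal_sum L l r Ss m cf"
proof (rule ex_ex1I[OF normal_sum_exists[OF assms]])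
  fix cf cf' :: "nat \<Rightarrow> nat monom \<Rightarrow> complex"
  assume cf: "(\<forall>a b. \<not> (a \<le> m \<and> b \<in> exponents (m - a)) \<longrightarrow> cf a b = 0) \<and> P = normal_sum L l r Ss m cf"
    and cf': "(\<forall>a b. \<not> (a \<le> m \<and> b \<in> exponents (m - a)) \<longrightarrow> cf' a b = 0) \<and> P = normal_sum L l r Ss m cf'"
  have "cf a b = cf' a b" for a b
    using normal_sum_inject[of m cf cf' a b] cf cf' by (cases "a \<le> m \<and> b \<in> exponents (m - a)") auto
  then show "cf = cf'" by blast
qed

end

theorem mainTheorem6:
  fixes n \<kappa> :: nat
    and L :: "jet_poly list"
    and l :: "nat list"
    and r :: "(nat monom \<times> nat monom) set"
    and Ss :: "nat cpoly list"
  assumes "n \<ge> 1" and "\<kappa> \<ge> 1"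
    and "(alg_loop n \<kappa>)\<^sup>*\<^sup>* (initial_list n \<kappa>) L"
    and "has_weights n \<kappa> L l"
    and "mutually_independent (f1' # L)"
    and "homogeneous_reduced_basis L l r Ss"
    and "\<forall>S\<in>set Ss. \<exists>R\<in>poly_ring {..<Suc (length L)}.
           0 = list_subst L S - f1' * list_subst (f1' # L) R"
  shows "terminates_at n \<kappa> L \<and>
    invariant_algebra n \<kappa> = generated_algebra (set (f1' # L)) \<and>
    (\<forall>m. \<forall>P\<in>invariants n \<kappa> m.
       \<exists>!cf. (\<forall>a b. \<not> (a \<le> m \<and> b \<in> normal_exponents l r Ss (m - a)) \<longrightarrow> cf a b = 0) \<and>
         P = normal_sum L l r Ss m cf) \<and>
    (\<forall>m cf. normal_sum L l r Ss m cf \<in> invariants n \<kappa> m)"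
proof -
  interpret closed_list n \<kappa> L l r Ss
  proof
    show "set (initial_list n \<kappa>) \<subseteq> set L" by (rule alg_loop_star_superset[OF assms(3)])
    show "monomial_order (length L) r" "reduced_groebner_basis (length L) r (relations0 L) (set Ss)"
      using assms(6) by (auto simp: homogeneous_reduced_basis_def)
    show "\<exists>R\<in>poly_ring {..<Suc (length L)}. list_subst L S = f1' * list_subst (f1' # L) R"
      if "S \<in> set Ss" for S using assms(7) that by fastforce
    \<comment> \<open>A member of weight 0 is a constant and so lies in the algebra generated by the
      others, against mutual independence. Its index is \<open>Suc j\<close> because
      \<open>f1'\<close> heads the list.\<close>
    show "l ! j \<noteq> 0" if j: "j < length L" for j
    proof
      assume "l ! j = 0"
      then have "L ! j \<in> invariants n \<kappa> 0" using assms(4) j by (auto simp: has_weights_def)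
      then obtain c where c: "L ! j = const c" using invariants_0_const by blast
      have "(f1' # L) ! Suc j \<notin>
          generated_algebra {(f1' # L) ! i |i. i < length (f1' # L) \<and> i \<noteq> Suc j}"
        using assms(5)[unfolded mutually_independent_def, rule_format, of "Suc j"] j by simp
      then show False unfolding nth_Cons_Suc c by (rule notE) (rule generated_algebra.const)
    qed
  qed (rule assms)+
  show ?thesis
    by (intro conjI allI ballI terminates[OF assms(6)] invariant_algebra_eq
        normal_sum_exists_unique normal_sum_invariant)
qed

end
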